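(* Let $\mathbf{FQSym}$ denote the $\mathbb{K}$-span of the $\mathbf{G}_\sigma$, $\sigma\in\mathfrak{S}_n$, $n\ge1$, equipped with the product $\#$ (an associative algebra with unit $\mathbf{G}_1$). Then $(\mathbf{FQSym},\#)$ is a free associative unital algebra, freely generated by $\{\mathbf{S}^\alpha:\alpha\text{ non-secable}\}$, and also freely generated by $\{\mathbf{G}_\alpha:\alpha\text{ non-secable}\}$.
   Context: Let $A=\{a_1<a_2<\cdots\}$ be an infinite totally ordered alphabet and $\mathbb{K}$ a field; work with formal $\mathbb{K}$-linear combinations of nonempty words over $A$. The $\#$ product of words is $(ux)\#(yv)=uxv$ if the letters $x,y$ are equal and $0$ otherwise ($u,v$ words, $x,y$ letters), extended bilinearly. $\mathrm{std}(w)$ is the standardization of a word $w$ (number left to right the occurrences of the smallest letter $1,2,\dots$, then those of the next letter, etc.), and $\mathbf{G}_\sigma=\sum_{\mathrm{std}(w)=\sigma}w$. With $\mathrm{Inv}(\sigma)=\{(i,j):i<j,\ \sigma_i>\sigma_j\}$, the left weak order is $\sigma\le\tau$ iff $\mathrm{Inv}(\sigma)\subseteq\mathrm{Inv}(\tau)$, and $\mathbf{S}^\sigma=\sum_{\tau\le\sigma}\mathbf{G}_\tau$. A permutation $\alpha\in\mathfrak{S}_n$ is non-secable if $n\ge2$ and for every $k$ with $2\le k<n$, the set $\{\alpha_1,\dots,\alpha_k\}$ is not the union of an interval of integers with maximal element $\alpha_k$ and another interval of integers which is either empty or has maximal element $n$. *)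

theory Defs
  imports
    "HOL-Library.Function_Algebras"
    "HOL-Combinatorics.Multiset_Permutations"
begin

section \<open>Unital associative algebras and freeness\<close>

text \<open>An algebra over the field \<open>'k\<close> lives on a subspace \<open>A\<close> of an ambient vector space.\<close>

locale unital_algebra = vector_space scale
  for scale :: "'k::field \<Rightarrow> 'v::ab_group_add \<Rightarrow> 'v" +
  fixes A :: "'v set" and mul :: "'v \<Rightarrow> 'v \<Rightarrow> 'v" and one :: 'v
  assumes subspace_carrier: "subspace A"
    and mul_closed: "x \<in> A \<Longrightarrow> y \<in> A \<Longrightarrow> mul x y \<in> A"
    and one_closed: "one \<in> A"
    and mul_add_left: "x \<in> A \<Longrightarrow> y \<in> A \<Longrightarrow> z \<in> A \<Longrightarrow> mul (x + y) z = mul x z + mul y z"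
    and mul_add_right: "x \<in> A \<Longrightarrow> y \<in> A \<Longrightarrow> z \<in> A \<Longrightarrow> mul x (y + z) = mul x y + mul x z"
    and mul_scale_left: "x \<in> A \<Longrightarrow> y \<in> A \<Longrightarrow> mul (scale c x) y = scale c (mul x y)"
    and mul_scale_right: "x \<in> A \<Longrightarrow> y \<in> A \<Longrightarrow> mul x (scale c y) = scale c (mul x y)"
    and mul_assoc: "x \<in> A \<Longrightarrow> y \<in> A \<Longrightarrow> z \<in> A \<Longrightarrow> mul (mul x y) z = mul x (mul y z)"
    and one_left: "x \<in> A \<Longrightarrow> mul one x = x"
    and one_right: "x \<in> A \<Longrightarrow> mul x one = x"

definition unital_algebra_iso ::
  "('k::field \<Rightarrow> 'v::ab_group_add \<Rightarrow> 'v) \<Rightarrow> 'v set \<Rightarrow> ('v \<Rightarrow> 'v \<Rightarrow> 'v) \<Rightarrow> 'v \<Rightarrow>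
   ('k \<Rightarrow> 'w::ab_group_add \<Rightarrow> 'w) \<Rightarrow> 'w set \<Rightarrow> ('w \<Rightarrow> 'w \<Rightarrow> 'w) \<Rightarrow> 'w \<Rightarrow> ('v \<Rightarrow> 'w) \<Rightarrow> bool" where
  "unital_algebra_iso scaleA A mulA oneA scaleB B mulB oneB \<Phi> \<longleftrightarrow>
     bij_betw \<Phi> A B \<and>
     (\<forall>x\<in>A. \<forall>y\<in>A. \<Phi> (x + y) = \<Phi> x + \<Phi> y) \<and>
     (\<forall>c. \<forall>x\<in>A. \<Phi> (scaleA c x) = scaleB c (\<Phi> x)) \<and>
     (\<forall>x\<in>A. \<forall>y\<in>A. \<Phi> (mulA x y) = mulB (\<Phi> x) (\<Phi> y)) \<and>
     \<Phi> oneA = oneB"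

text \<open>
  A function from words to \<open>'k\<close> stands for the formal linear combination of words with these
  coefficients.  Addition, zero and sums are the pointwise ones of
  \<^theory>\<open>HOL-Library.Function_Algebras\<close>; its pointwise product is not used.
\<close>

definition series_scale :: "'k::field \<Rightarrow> ('x \<Rightarrow> 'k) \<Rightarrow> 'x \<Rightarrow> 'k" where
  "series_scale c f = (\<lambda>w. c * f w)"

definition monomial :: "'x \<Rightarrow> 'x \<Rightarrow> 'k::field" where
  "monomial v = (\<lambda>w. if w = v then 1 else 0)"

text \<open>
  The free algebra \<open>K\<langle>X\<rangle>\<close>: finite linear combinations of words over \<open>X\<close> (the empty word included),
  multiplied by concatenation, with the empty word as unit.
\<close>

definition free_algebra :: "'x set \<Rightarrow> ('x list \<Rightarrow> 'k::field) set" where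
  "free_algebra X = {p. finite {w. p w \<noteq> 0} \<and> {w. p w \<noteq> 0} \<subseteq> lists X}"

definition conc_mul :: "('x list \<Rightarrow> 'k::field) \<Rightarrow> ('x list \<Rightarrow> 'k) \<Rightarrow> 'x list \<Rightarrow> 'k" where
  "conc_mul p q = (\<lambda>w. \<Sum>(u, v) \<in> {(u, v). u @ v = w}. p u * q v)"

definition freely_generated_by ::
  "('k::field \<Rightarrow> 'v::ab_group_add \<Rightarrow> 'v) \<Rightarrow> 'v set \<Rightarrow> ('v \<Rightarrow> 'v \<Rightarrow> 'v) \<Rightarrow> 'v \<Rightarrow> 'v set \<Rightarrow> bool" where
  "freely_generated_by scale A mul one X \<longleftrightarrow>
     unital_algebra scale A mul one \<and> X \<subseteq> A \<and>
     (\<exists>\<Phi>. unital_algebra_iso series_scale (free_algebra X) conc_mul (monomial [])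
            scale A mul one \<Phi> \<and>
          (\<forall>x\<in>X. \<Phi> (monomial [x]) = x))"


section \<open>The \<open>#\<close> product\<close>

text \<open>\<^const>\<open>None\<close> stands for the product being zero.\<close>

definition sharp_word :: "'a list \<Rightarrow> 'a list \<Rightarrow> 'a list option" where
  "sharp_word p q =
     (if p \<noteq> [] \<and> q \<noteq> [] \<and> last p = hd q then Some (p @ tl q) else None)"

text \<open>
  Bilinear extension to arbitrary, possibly infinite, linear combinations; each coefficient is a
  finite sum by the lemma \<open>finite_sharp_word\<close> below.
\<close>

definition sharp :: "('a list \<Rightarrow> 'k::field) \<Rightarrow> ('a list \<Rightarrow> 'k) \<Rightarrow> 'a list \<Rightarrow> 'k" where
  "sharp f g = (\<lambda>w. \<Sum>(p, q) \<in> {(p, q). sharp_word p q = Some w}. f p * g q)"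

lemma sharp_word_snoc_Cons:
  "sharp_word (u @ [x]) (y # v) = (if x = y then Some (u @ [x] @ v) else None)"
  by (simp add: sharp_word_def)

lemma finite_sharp_word: "finite {(p, q). sharp_word p q = Some w}"
proof (rule finite_subset)
  show "{(p, q). sharp_word p q = Some w} \<subseteq> (\<lambda>i. (take i w, drop (i - 1) w)) ` {..length w}"
  proof clarify
    fix p q assume "sharp_word p q = Some w"
    then have pq: "p \<noteq> []" "q \<noteq> []" "last p = hd q" "w = p @ tl q"
      by (auto simp: sharp_word_def split: if_splits)
    obtain u x where p: "p = u @ [x]"
      using pq(1) by (cases p rule: rev_exhaust) auto
    obtain v where q: "q = x # v"
      using pq(2,3) p by (cases q) auto
    have "(p, q) = (take (length p) w, drop (length p - 1) w)"
      using pq(4) p q by simp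
    moreover have "length p \<in> {..length w}"
      using pq(4) by simp
    ultimately show "(p, q) \<in> (\<lambda>i. (take i w, drop (i - 1) w)) ` {..length w}"
      by (rule image_eqI)
  qed
qed simp

lemma finite_conc: "finite {(u, v). u @ v = w}"
proof (rule finite_subset)
  show "{(u, v). u @ v = w} \<subseteq> (\<lambda>i. (take i w, drop i w)) ` {..length w}"
  proof clarify
    fix u v :: "'a list"
    show "(u, v) \<in> (\<lambda>i. (take i (u @ v), drop i (u @ v))) ` {..length (u @ v)}"
      by (rule image_eqI[where x = "length u"]) auto
  qed
qed simp


section \<open>Standardization and the bases of \<open>FQSym\<close>\<close>

text \<open>
  A permutation of \<open>{1..n}\<close> is the list of its values.  The number given to position \<open>i\<close> of \<open>w\<close> by
  standardization is the number of positions that are numbered no later than \<open>i\<close>.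
\<close>

definition std :: "'a::linorder list \<Rightarrow> nat list" where
  "std w = map (\<lambda>i. card {j. j < length w \<and> (w ! j < w ! i \<or> w ! j = w ! i \<and> j \<le> i)})
             [0..<length w]"

definition G :: "nat list \<Rightarrow> 'a::linorder list \<Rightarrow> 'k::field" where
  "G \<sigma> = (\<lambda>w. if std w = \<sigma> then 1 else 0)"

definition Inv :: "nat list \<Rightarrow> (nat \<times> nat) set" where
  "Inv \<sigma> = {(i, j). i < j \<and> j < length \<sigma> \<and> \<sigma> ! i > \<sigma> ! j}"

definition left_weak_le :: "nat list \<Rightarrow> nat list \<Rightarrow> bool" where
  "left_weak_le \<sigma> \<tau> \<longleftrightarrow> length \<sigma> = length \<tau> \<and> Inv \<sigma> \<subseteq> Inv \<tau>"

definition S :: "nat list \<Rightarrow> 'a::linorder list \<Rightarrow> 'k::field" where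
  "S \<sigma> = (\<Sum>\<tau> \<in> {\<tau> \<in> permutations_of_set {1..length \<sigma>}. left_weak_le \<tau> \<sigma>}. G \<tau>)"

definition FQSym :: "('a::linorder list \<Rightarrow> 'k::field) set" where
  "FQSym = module.span series_scale {G \<sigma> | \<sigma> n. n \<ge> 1 \<and> \<sigma> \<in> permutations_of_set {1..n}}"

text \<open>
  \<open>\<alpha>\<^sub>k\<close> is \<open>\<alpha> ! (k - 1)\<close>.  The bound \<open>a \<le> \<alpha>\<^sub>k\<close> makes the first interval nonempty, so that its
  maximum is \<open>\<alpha>\<^sub>k\<close>; the second one, \<open>{b..n}\<close>, is empty when \<open>b > n\<close>.
\<close>

definition non_secable :: "nat list \<Rightarrow> bool" where
  "non_secable \<alpha> \<longleftrightarrow>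
     (let n = length \<alpha> in
        \<alpha> \<in> permutations_of_set {1..n} \<and> n \<ge> 2 \<and>
        (\<forall>k. 2 \<le> k \<and> k < n \<longrightarrow>
           \<not> (\<exists>a b. a \<le> \<alpha> ! (k - 1) \<and> set (take k \<alpha>) = {a..\<alpha> ! (k - 1)} \<union> {b..n})))"

end

theory Submission
  imports Defs
begin

text \<open>
  Among the permutations \<open>\<nu>\<close> whose prefix of length \<open>n\<close> and suffix of length \<open>m\<close>, overlapping in one
  letter, standardize to \<open>\<alpha>\<close> and \<open>\<beta>\<close>, there is a largest one \<open>\<alpha> \<bullet> \<beta>\<close> for the left weak order. Hence
  \<open>G \<alpha> # G \<beta>\<close> is \<open>G (\<alpha> \<bullet> \<beta>)\<close> plus lower terms, and the same holds for any two elements that are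
  unitriangular in the basis \<open>G\<close>, such as \<open>S \<alpha>\<close> and \<open>S \<beta>\<close>. A permutation \<open>\<mu>\<close> splits as \<open>\<alpha> \<bullet> \<beta>\<close> at the letter
  in position \<open>p\<close> iff \<open>\<mu>\<^sub>i < \<mu>\<^sub>j\<close> with \<open>i < p < j\<close> forces \<open>\<mu>\<^sub>i < \<mu>\<^sub>p < \<mu>\<^sub>j\<close>; in terms of intervals
  this is secability. Cutting at the first such position factorizes every permutation uniquely into
  non-secable ones, so products of generators are unitriangular with pairwise distinct leading
  terms that exhaust the basis \<open>G\<close>.
\<close>

section \<open>Free generation from a basis of products\<close>

text \<open>Splittings outside finite sets containing the supports contribute zero. With one box
  \<open>P \<times> Q\<close> for all words, the terms of a product can be regrouped.\<close>

lemma conc_mul_eq_sum: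
  assumes "finite P" "finite Q" "{u. p u \<noteq> 0} \<subseteq> P" "{v. q v \<noteq> 0} \<subseteq> Q"
  shows "conc_mul p q w = (\<Sum>(u, v) \<in> {z \<in> P \<times> Q. fst z @ snd z = w}. p u * q v)"
  unfolding conc_mul_def
proof (rule sum.mono_neutral_right)
  show "finite {(u, v). u @ v = w}" by (rule finite_conc)
  show "{z \<in> P \<times> Q. fst z @ snd z = w} \<subseteq> {(u, v). u @ v = w}" by auto
  show "\<forall>z\<in>{(u, v). u @ v = w} - {z \<in> P \<times> Q. fst z @ snd z = w}. (case z of (u, v) \<Rightarrow> p u * q v) = 0"
    using assms(3,4) by auto
qed

context unital_algebra
begin

abbreviation word_prod :: "'v list \<Rightarrow> 'v" where
  "word_prod w \<equiv> foldr mul w one"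

text \<open>The evaluation homomorphism from the free algebra: letters are themselves elements of
  the algebra, and each is sent to itself. It serves as the isomorphism in
  \<open>freely_generated_by\<close>.\<close>

definition poly_eval :: "('v list \<Rightarrow> 'k) \<Rightarrow> 'v" where
  "poly_eval p = (\<Sum>w \<in> {w. p w \<noteq> 0}. scale (p w) (word_prod w))"

lemma poly_eval_eq:
  assumes "finite W" "{w. p w \<noteq> 0} \<subseteq> W"
  shows "poly_eval p = (\<Sum>w\<in>W. scale (p w) (word_prod w))"
  unfolding poly_eval_def using assms by (intro sum.mono_neutral_left) auto

lemma word_prod_closed: "w \<in> lists A \<Longrightarrow> word_prod w \<in> A"
  by (induction w) (auto simp: one_closed mul_closed)

lemma word_prod_append:
  "u \<in> lists A \<Longrightarrow> v \<in> lists A \<Longrightarrow> word_prod (u @ v) = mul (word_prod u) (word_prod v)"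
  by (induction u) (auto simp: one_left mul_assoc word_prod_closed)

lemma mul_zero_left: "x \<in> A \<Longrightarrow> mul 0 x = 0"
  using mul_scale_left[of x x 0] by simp

lemma mul_zero_right: "x \<in> A \<Longrightarrow> mul x 0 = 0"
  using mul_scale_right[of x x 0] by simp

lemma mul_sum_left:
  assumes "\<And>i. i \<in> I \<Longrightarrow> f i \<in> A" "x \<in> A"
  shows "mul (sum f I) x = (\<Sum>i\<in>I. mul (f i) x)"
  using assms(1)
  by (induction I rule: infinite_finite_induct)
    (auto simp: mul_zero_left assms(2) mul_add_left subspace_sum[OF subspace_carrier])

lemma mul_sum_right:
  assumes "\<And>i. i \<in> I \<Longrightarrow> f i \<in> A" "x \<in> A"
  shows "mul x (sum f I) = (\<Sum>i\<in>I. mul x (f i))"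
  using assms(1)
  by (induction I rule: infinite_finite_induct)
    (auto simp: mul_zero_right assms(2) mul_add_right subspace_sum[OF subspace_carrier])

lemma poly_eval_conc_mul:
  assumes "p \<in> free_algebra A" "q \<in> free_algebra A"
  shows "poly_eval (conc_mul p q) = mul (poly_eval p) (poly_eval q)"
proof -
  let ?P = "{w. p w \<noteq> 0}" and ?Q = "{w. q w \<noteq> 0}"
  let ?c = "\<lambda>z. fst z @ snd z"
  let ?t = "\<lambda>z. scale (p (fst z) * q (snd z)) (word_prod (?c z))"
  have fin: "finite ?P" "finite ?Q" and sub: "?P \<subseteq> lists A" "?Q \<subseteq> lists A"
    using assms by (auto simp: free_algebra_def)
  note conc = conc_mul_eq_sum[OF fin order_refl order_refl]
  have supp: "{w. conc_mul p q w \<noteq> 0} \<subseteq> ?c ` (?P \<times> ?Q)"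
  proof
    fix w assume "w \<in> {w. conc_mul p q w \<noteq> 0}"
    moreover have "conc_mul p q w = 0" if "{z \<in> ?P \<times> ?Q. ?c z = w} = {}"
      by (simp only: conc that sum.empty)
    ultimately show "w \<in> ?c ` (?P \<times> ?Q)" by blast
  qed
  have "poly_eval (conc_mul p q)
      = (\<Sum>w \<in> ?c ` (?P \<times> ?Q). scale (conc_mul p q w) (word_prod w))"
    using fin by (intro poly_eval_eq supp) simp
  also have "\<dots> = (\<Sum>w \<in> ?c ` (?P \<times> ?Q). \<Sum>z \<in> {z \<in> ?P \<times> ?Q. ?c z = w}. ?t z)"
    by (simp only: conc scale_sum_left) (auto intro!: sum.cong)
  \<comment> \<open>The fibres of concatenation partition the pairs of words in the two
    supports.\<close>
  also have "\<dots> = (\<Sum>z \<in> ?P \<times> ?Q. ?t z)"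
    using fin by (intro sum.image_gen[symmetric]) simp
  also have "\<dots> = (\<Sum>u\<in>?P. \<Sum>v\<in>?Q. scale (p u * q v) (word_prod (u @ v)))"
    by (simp add: sum.cartesian_product case_prod_unfold)
  also have "\<dots> = (\<Sum>u\<in>?P. \<Sum>v\<in>?Q. mul (scale (p u) (word_prod u)) (scale (q v) (word_prod v)))"
  proof (intro sum.cong refl)
    fix u v assume "u \<in> ?P" "v \<in> ?Q"
    then have uv: "u \<in> lists A" "v \<in> lists A" using sub by blast+
    then show "scale (p u * q v) (word_prod (u @ v))
        = mul (scale (p u) (word_prod u)) (scale (q v) (word_prod v))"
      by (simp add: word_prod_append mul_scale_left mul_scale_right word_prod_closed
          subspace_scale[OF subspace_carrier] mult.commute del: foldr_append)
  qed
  also have "\<dots> = mul (poly_eval p) (poly_eval q)"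
  proof -
    have P: "scale (p u) (word_prod u) \<in> A" if "u \<in> ?P" for u
      using that sub by (intro subspace_scale[OF subspace_carrier] word_prod_closed) blast
    have Q: "scale (q u) (word_prod u) \<in> A" if "u \<in> ?Q" for u
      using that sub by (intro subspace_scale[OF subspace_carrier] word_prod_closed) blast
    show ?thesis
      unfolding poly_eval_def
      by (subst mul_sum_left, blast intro: P, rule subspace_sum[OF subspace_carrier Q], assumption)
        (auto intro!: sum.cong mul_sum_right[symmetric] P Q)
  qed
  finally show ?thesis .
qed

lemma poly_eval_monomial: "poly_eval (monomial w) = word_prod w"
proof -
  have "{v. (monomial w v :: 'k) \<noteq> 0} = {w}"
    by (auto simp: monomial_def)
  then show ?thesis by (simp add: poly_eval_def) (simp add: monomial_def)
qed

lemma poly_eval_add: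
  assumes "finite {w. p w \<noteq> 0}" "finite {w. q w \<noteq> 0}"
  shows "poly_eval (p + q) = poly_eval p + poly_eval q"
proof -
  let ?W = "{w. p w \<noteq> 0} \<union> {w. q w \<noteq> 0}"
  have "poly_eval (p + q) = (\<Sum>w\<in>?W. scale ((p + q) w) (word_prod w))"
    using assms by (intro poly_eval_eq) auto
  moreover have "poly_eval p = (\<Sum>w\<in>?W. scale (p w) (word_prod w))"
    using assms by (intro poly_eval_eq) auto
  moreover have "poly_eval q = (\<Sum>w\<in>?W. scale (q w) (word_prod w))"
    using assms by (intro poly_eval_eq) auto
  ultimately show ?thesis
    by (simp add: scale_left_distrib sum.distrib)
qed

lemma poly_eval_scale:
  assumes "finite {w. p w \<noteq> 0}"
  shows "poly_eval (series_scale c p) = scale c (poly_eval p)"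
proof -
  have "poly_eval (series_scale c p) = (\<Sum>w \<in> {w. p w \<noteq> 0}. scale (series_scale c p w) (word_prod w))"
    using assms by (intro poly_eval_eq) (auto simp: series_scale_def)
  then show ?thesis
    by (simp add: series_scale_def poly_eval_def scale_sum_right)
qed

text \<open>Freeness means that the products of generators form a basis indexed by words.
  Independence of a set does not see two words with the same product, hence the separate injectivity
  condition.\<close>

theorem freely_generated_byI:
  assumes X: "X \<subseteq> A"
    and inj: "inj_on word_prod (lists X)"
    and indep: "independent (word_prod ` lists X)"
    and span: "A \<subseteq> span (word_prod ` lists X)"
  shows "freely_generated_by scale A mul one X"
proof -
  let ?F = "free_algebra X :: ('v list \<Rightarrow> 'k) set"
  have FA: "?F \<subseteq> free_algebra A"
    using X by (fastforce simp: free_algebra_def)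
  have fin: "finite {w. p w \<noteq> 0}" and supp: "{w. p w \<noteq> 0} \<subseteq> lists X" if "p \<in> ?F" for p
    using that by (auto simp: free_algebra_def)
  have "inj_on poly_eval ?F"
  proof (rule inj_onI, rule ext)
    fix p q :: "'v list \<Rightarrow> 'k" and w
    assume p: "p \<in> ?F" and q: "q \<in> ?F" and eq: "poly_eval p = poly_eval q"
    let ?W = "{w. p w \<noteq> 0} \<union> {w. q w \<noteq> 0}"
    have W: "finite ?W" "?W \<subseteq> lists X"
      using fin[OF p] fin[OF q] supp[OF p] supp[OF q] by auto
    have injW: "inj_on word_prod ?W"
      using inj W(2) by (rule inj_on_subset)
    \<comment> \<open>The difference of coefficients, carried from words to their products;
      injectivity makes this well defined.\<close>
    let ?u = "\<lambda>x. p (the_inv_into ?W word_prod x) - q (the_inv_into ?W word_prod x)"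
    have "(\<Sum>x \<in> word_prod ` ?W. scale (?u x) x)
        = (\<Sum>w\<in>?W. scale (p w - q w) (word_prod w))"
      by (subst sum.reindex[OF injW]) (auto intro!: sum.cong simp: the_inv_into_f_f[OF injW])
    also have "\<dots> = poly_eval p - poly_eval q"
      using poly_eval_eq[OF W(1), of p] poly_eval_eq[OF W(1), of q]
      by (simp add: scale_left_diff_distrib sum_subtractf)
    finally have zero: "(\<Sum>x \<in> word_prod ` ?W. scale (?u x) x) = 0"
      using eq by simp
    show "p w = q w"
    proof (cases "w \<in> ?W")
      case True
      have "?u (word_prod w) = 0"
        using independentD[OF indep _ _ zero, of "word_prod w"] W True by blast
      then show ?thesis using the_inv_into_f_f[OF injW True] by simp
    qed auto
  qed
  moreover have "poly_eval ` ?F = A"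
  proof
    show "poly_eval ` ?F \<subseteq> A"
    proof clarify
      fix p assume p: "p \<in> ?F"
      show "poly_eval p \<in> A"
        unfolding poly_eval_def using supp[OF p] X
        by (intro subspace_sum[OF subspace_carrier] subspace_scale[OF subspace_carrier]
            word_prod_closed) blast
    qed
    show "A \<subseteq> poly_eval ` ?F"
    proof
      fix x assume "x \<in> A"
      then have "x \<in> span (word_prod ` lists X)" using span by blast
      then obtain T c where T: "finite T" "T \<subseteq> word_prod ` lists X" "x = (\<Sum>v\<in>T. scale (c v) v)"
        by (auto simp: span_explicit)
      then obtain W where W: "W \<subseteq> lists X" "finite W" "T = word_prod ` W"
        using finite_subset_image[OF T(1,2)] by blast
      have injW: "inj_on word_prod W" using inj W(1) by (rule inj_on_subset)
      \<comment> \<open>Each vector of the combination is represented by one word in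
        \<open>W\<close>, which receives its coefficient.\<close>
      define p where "p w = (if w \<in> W then c (word_prod w) else 0)" for w
      have "p \<in> ?F"
        using W by (auto simp: p_def free_algebra_def intro: finite_subset[OF _ W(2)])
      moreover have "poly_eval p = x"
        using W(2) by (subst poly_eval_eq[of W]) (auto simp: p_def T(3) W(3) sum.reindex[OF injW])
      ultimately show "x \<in> poly_eval ` ?F" by blast
    qed
  qed
  ultimately have "bij_betw poly_eval ?F A"
    by (simp add: bij_betw_def)
  then have "unital_algebra_iso series_scale ?F conc_mul (monomial []) scale A mul one poly_eval"
    using FA by (auto simp: unital_algebra_iso_def poly_eval_add poly_eval_scale fin
        poly_eval_monomial poly_eval_conc_mul subset_iff)
  moreover have "\<forall>x\<in>X. poly_eval (monomial [x]) = x"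
    using X by (auto simp: poly_eval_monomial one_right)
  ultimately show ?thesis
    unfolding freely_generated_by_def using X unital_algebra_axioms by blast
qed

end

section \<open>Inversions and standardization\<close>

text \<open>\<open>Inv\<close> for words over any linear order, so that words and permutations are
  compared by one notion.\<close>

definition inversions :: "'a::linorder list \<Rightarrow> (nat \<times> nat) set" where
  "inversions w = {(i, j). i < j \<and> j < length w \<and> w ! j < w ! i}"

lemma Inv_eq_inversions: "Inv = inversions"
  by (auto simp: Inv_def inversions_def fun_eq_iff)

lemma finite_inversions: "finite (inversions w)"
  by (rule finite_subset[of _ "{..<length w} \<times> {..<length w}"]) (auto simp: inversions_def)

lemma length_std [simp]: "length (std w) = length w"
  by (simp add: std_def)

text \<open>The order in which standardization numbers the positions. It is reflexive: every
  position counts itself, so the numbers start at 1.\<close>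

definition precedes :: "'a::linorder list \<Rightarrow> nat \<Rightarrow> nat \<Rightarrow> bool" where
  "precedes w j i \<longleftrightarrow> w ! j < w ! i \<or> w ! j = w ! i \<and> j \<le> i"

lemma nth_std: "i < length w \<Longrightarrow> std w ! i = card {j. j < length w \<and> precedes w j i}"
  by (simp add: std_def precedes_def)

lemma precedes_iff_inversions:
  "i < length w \<Longrightarrow> j < length w \<Longrightarrow>
    precedes w j i \<longleftrightarrow> (if j \<le> i then (j, i) \<notin> inversions w else (i, j) \<in> inversions w)"
  by (auto simp: precedes_def inversions_def)

text \<open>The numbering order can be read off from the inversions, and \<open>std\<close> depends
  on nothing else.\<close>

lemma std_cong:
  assumes "length w = length v" "inversions w = inversions v"
  shows "std w = std v"
proof (rule nth_equalityI)
  fix i assume i: "i < length (std w)"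
  have "{j. j < length w \<and> precedes w j i} = {j. j < length v \<and> precedes v j i}"
    using assms i by (auto simp: precedes_iff_inversions)
  then show "std w ! i = std v ! i"
    using i assms(1) by (simp add: nth_std)
qed (use assms in simp)

text \<open>Whatever is numbered no later than \<open>i\<close> is numbered no later than
  \<open>j\<close>, and \<open>j\<close> itself is new.\<close>

lemma std_nth_less:
  assumes "i < length w" "j < length w" "precedes w i j" "i \<noteq> j"
  shows "std w ! i < std w ! j"
proof -
  have "{k. k < length w \<and> precedes w k i} \<subset> {k. k < length w \<and> precedes w k j}"
    using assms by (force simp: precedes_def)
  then show ?thesis
    using assms by (simp add: nth_std psubset_card_mono)
qed

text \<open>Equal letters are numbered from left to right, so ties create no inversion.\<close>

lemma inversions_std [simp]: "inversions (std w) = inversions w"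
proof -
  have "std w ! j < std w ! i \<longleftrightarrow> w ! j < w ! i" if "i < j" "j < length w" for i j
  proof (cases "w ! j < w ! i")
    case True
    then show ?thesis using that std_nth_less[of j w i] by (auto simp: precedes_def)
  next
    case False
    then show ?thesis using that std_nth_less[of i w j] by (force simp: precedes_def)
  qed
  then show ?thesis by (auto simp: inversions_def)
qed

text \<open>Reduces questions about \<open>std\<close> to inversion sets, which restrict directly to
  prefixes and suffixes.\<close>

lemma std_eq_iff: "std w = std v \<longleftrightarrow> length w = length v \<and> inversions w = inversions v"
  using std_cong[of w v] inversions_std[of w] inversions_std[of v] length_std[of w] length_std[of v]
  by metis

definition Perms :: "nat list set" where
  "Perms = {\<sigma>. \<sigma> \<noteq> [] \<and> \<sigma> \<in> permutations_of_set {1..length \<sigma>}}"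

lemma std_in_permutations: "std w \<in> permutations_of_set {1..length w}"
proof -
  have "distinct (std w)"
  proof -
    have "std w ! i \<noteq> std w ! j" if "i < length w" "j < length w" "i \<noteq> j" for i j
    proof -
      have "precedes w i j \<or> precedes w j i"
        by (auto simp: precedes_def)
      then show ?thesis
        using that std_nth_less[of i w j] std_nth_less[of j w i] by auto
    qed
    then show ?thesis by (simp add: distinct_conv_nth)
  qed
  moreover have "set (std w) \<subseteq> {1..length w}"
  proof
    fix x assume "x \<in> set (std w)"
    then obtain i where i: "i < length w" "x = std w ! i"
      by (metis in_set_conv_nth length_std)
    have "i \<in> {j. j < length w \<and> precedes w j i}" using i by (simp add: precedes_def)
    then have "card {j. j < length w \<and> precedes w j i} > 0" by (auto simp: card_gt_0_iff)
    moreover have "card {j. j < length w \<and> precedes w j i} \<le> card {..<length w}"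
      by (rule card_mono) auto
    ultimately show "x \<in> {1..length w}" using i by (simp add: nth_std)
  qed
  ultimately show ?thesis
    by (simp add: permutations_of_set_def card_subset_eq distinct_card)
qed

lemma std_eq_Nil_iff [simp]: "std w = [] \<longleftrightarrow> w = []"
  by (simp add: std_def)

lemma std_in_Perms: "w \<noteq> [] \<Longrightarrow> std w \<in> Perms"
  using std_in_permutations[of w] by (simp add: Perms_def)

text \<open>The entries up to the value \<open>\<sigma> ! i\<close> are exactly \<open>1\<close>,
  ..., \<open>\<sigma> ! i\<close>, so counting them returns this value.\<close>

lemma std_permutation:
  assumes "\<sigma> \<in> permutations_of_set {1..length \<sigma>}"
  shows "std \<sigma> = \<sigma>"
proof (rule nth_equalityI)
  fix i assume "i < length (std \<sigma>)"
  then have i: "i < length \<sigma>" by simp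
  have set: "set \<sigma> = {1..length \<sigma>}" and dist: "distinct \<sigma>"
    using assms by (auto simp: permutations_of_set_def)
  let ?J = "{j. j < length \<sigma> \<and> precedes \<sigma> j i}"
  have "(!) \<sigma> ` ?J = {1..\<sigma> ! i}"
  proof
    show "(!) \<sigma> ` ?J \<subseteq> {1..\<sigma> ! i}"
      using set by (force simp: precedes_def dest: nth_mem)
    show "{1..\<sigma> ! i} \<subseteq> (!) \<sigma> ` ?J"
    proof
      fix v assume v: "v \<in> {1..\<sigma> ! i}"
      then have "v \<in> set \<sigma>" using nth_mem[OF i] set by auto
      then obtain j where "j < length \<sigma>" "v = \<sigma> ! j" by (metis in_set_conv_nth)
      then show "v \<in> (!) \<sigma> ` ?J"
        using v i dist by (intro image_eqI[of _ _ j]) (auto simp: precedes_def nth_eq_iff_index_eq)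
    qed
  qed
  moreover have "inj_on ((!) \<sigma>) ?J"
    using dist by (auto simp: inj_on_def nth_eq_iff_index_eq)
  ultimately have "card ?J = \<sigma> ! i"
    by (metis card_atLeastAtMost card_image diff_Suc_1)
  then show "std \<sigma> ! i = \<sigma> ! i" using i by (simp add: nth_std)
qed simp

lemma std_Perms: "\<sigma> \<in> Perms \<Longrightarrow> std \<sigma> = \<sigma>"
  by (simp add: Perms_def std_permutation)

lemma Perms_eqI:
  assumes "\<sigma> \<in> Perms" "\<tau> \<in> Perms" "length \<sigma> = length \<tau>" "inversions \<sigma> = inversions \<tau>"
  shows "\<sigma> = \<tau>"
proof -
  have "\<sigma> = std \<sigma>" by (simp only: std_Perms[OF assms(1)])
  also have "\<dots> = std \<tau>" by (rule std_cong[OF assms(3,4)])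
  also have "\<dots> = \<tau>" by (rule std_Perms[OF assms(2)])
  finally show ?thesis .
qed

lemma inversions_take:
  "inversions (take k w) = {(i, j). (i, j) \<in> inversions w \<and> j < k}"
  unfolding inversions_def by auto

lemma inversions_drop:
  "inversions (drop k w) = {(i, j). (k + i, k + j) \<in> inversions w}"
  unfolding inversions_def by auto

lemma length_one_Perms: "\<sigma> \<in> Perms \<Longrightarrow> length \<sigma> = 1 \<Longrightarrow> \<sigma> = [1]"
proof -
  assume "\<sigma> \<in> Perms" and len: "length \<sigma> = 1"
  then have "set \<sigma> = {1}" by (simp add: Perms_def permutations_of_set_def)
  moreover obtain x where "\<sigma> = [x]" using len by (cases \<sigma>) auto
  ultimately show ?thesis by simp
qed

lemma std_eq_one_iff: "std w = [1] \<longleftrightarrow> length w = 1"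
proof
  assume "std w = [1]"
  then have "length (std w) = 1" by simp
  then show "length w = 1" by simp
next
  assume "length w = 1"
  then show "std w = [1]" by (intro length_one_Perms std_in_Perms) auto
qed

section \<open>Cuts and composition of permutations\<close>

text \<open>Positions count from 0. Only inversions occur, so the notion is invariant under
  \<open>std\<close>. It says that a pair across \<open>p\<close> is left uninverted only where
  transitivity through position \<open>p\<close> forces this.\<close>

definition cut_at :: "'a::linorder list \<Rightarrow> nat \<Rightarrow> bool" where
  "cut_at w p \<longleftrightarrow> (\<forall>i j. i < p \<and> p < j \<and> j < length w \<and> (i, j) \<notin> inversions w \<longrightarrow>
     (i, p) \<notin> inversions w \<and> (p, j) \<notin> inversions w)"

lemma cut_std [simp]: "cut_at (std w) p \<longleftrightarrow> cut_at w p"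
  by (simp add: cut_at_def)

lemma cut_last: "length w \<le> Suc p \<Longrightarrow> cut_at w p"
  by (auto simp: cut_at_def)

lemma cut_take:
  assumes "cut_at w p"
  shows "cut_at (take k w) p"
  unfolding cut_at_def
proof (intro allI impI)
  fix i j assume ij: "i < p \<and> p < j \<and> j < length (take k w) \<and> (i, j) \<notin> inversions (take k w)"
  then have "(i, j) \<notin> inversions w" by (auto simp: inversions_take)
  then have "(i, p) \<notin> inversions w \<and> (p, j) \<notin> inversions w"
    using assms ij by (auto simp: cut_at_def)
  then show "(i, p) \<notin> inversions (take k w) \<and> (p, j) \<notin> inversions (take k w)"
    by (simp add: inversions_take)
qed

text \<open>For \<open>j\<close> beyond \<open>q\<close>, the cut at \<open>q\<close> puts
  \<open>w ! q\<close> between \<open>w ! i\<close> and \<open>w ! j\<close>; the pair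
  \<open>(i, q)\<close> then lies in the prefix, where the cut at \<open>p\<close> applies. Hence
  the prefix up to the first cut has no earlier cut of its own.\<close>

lemma cut_of_take:
  assumes "cut_at w q" "cut_at (take (Suc q) w) p" "p < q"
  shows "cut_at w p"
proof -
  have q: "w ! i \<le> w ! q \<and> w ! q \<le> w ! j" if "i < q" "q < j" "j < length w" "w ! i \<le> w ! j" for i j
    using assms(1) that by (auto simp: cut_at_def inversions_def not_less)
  have p: "w ! i \<le> w ! p \<and> w ! p \<le> w ! j"
    if "i < p" "p < j" "j < length w" "j \<le> q" "w ! i \<le> w ! j" for i j
    using assms(2)[unfolded cut_at_def, rule_format, of i j] that
    by (auto simp: inversions_def not_less)
  have "w ! i \<le> w ! p \<and> w ! p \<le> w ! j" if "i < p" "p < j" "j < length w" "w ! i \<le> w ! j" for i j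
  proof (cases "j \<le> q")
    case True
    then show ?thesis using p that by blast
  next
    case False
    then have "w ! i \<le> w ! q \<and> w ! q \<le> w ! j" using q[of i j] that assms(3) by auto
    moreover have "w ! i \<le> w ! p \<and> w ! p \<le> w ! q"
      using p[of i q] calculation that assms(3) False by auto
    ultimately show ?thesis by auto
  qed
  then show ?thesis by (auto simp: cut_at_def inversions_def not_less)
qed

text \<open>Given the intervals, a prefix value below a later value cannot lie in the upper
  interval, which reaches \<open>n\<close>; so it lies in the lower one, and the later value must
  exceed \<open>\<alpha> ! p\<close>. Conversely, a cut makes the prefix values up to
  \<open>\<alpha> ! p\<close> and those above it upward closed, up to \<open>\<alpha> ! p\<close>
  and \<open>n\<close> respectively.\<close>

lemma cut_iff_intervals:
  assumes perm: "\<alpha> \<in> permutations_of_set {1..n}" and n: "n = length \<alpha>" and p: "p < n"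
  shows "(\<exists>a b. a \<le> \<alpha> ! p \<and> set (take (Suc p) \<alpha>) = {a..\<alpha> ! p} \<union> {b..n}) \<longleftrightarrow> cut_at \<alpha> p"
proof -
  have set: "set \<alpha> = {1..n}" and dist: "distinct \<alpha>"
    using perm by (auto simp: permutations_of_set_def)
  let ?T = "set (take (Suc p) \<alpha>)"
  have inT: "\<alpha> ! i \<in> ?T \<longleftrightarrow> i \<le> p" if "i < n" for i
    using that p n dist
    by (auto simp: in_set_conv_nth nth_eq_iff_index_eq less_Suc_eq_le)
  have neq: "\<alpha> ! i = \<alpha> ! j \<longleftrightarrow> i = j" if "i < n" "j < n" for i j
    using that n dist by (simp add: nth_eq_iff_index_eq)
  have range: "1 \<le> \<alpha> ! i" "\<alpha> ! i \<le> n" if "i < n" for i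
    using that n set nth_mem[of i \<alpha>] by auto
  have obt: "\<exists>i<n. v = \<alpha> ! i" if "1 \<le> v" "v \<le> n" for v
    using that n set by (metis atLeastAtMost_iff in_set_conv_nth)
  have cut_at: "cut_at \<alpha> p \<longleftrightarrow>
      (\<forall>i j. i < p \<and> p < j \<and> j < n \<and> \<alpha> ! i < \<alpha> ! j \<longrightarrow> \<alpha> ! i < \<alpha> ! p \<and> \<alpha> ! p < \<alpha> ! j)"
  proof -
    have "((i, j) \<notin> inversions \<alpha> \<longrightarrow> (i, p) \<notin> inversions \<alpha> \<and> (p, j) \<notin> inversions \<alpha>) \<longleftrightarrow>
        (\<alpha> ! i < \<alpha> ! j \<longrightarrow> \<alpha> ! i < \<alpha> ! p \<and> \<alpha> ! p < \<alpha> ! j)"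
      if "i < p" "p < j" "j < n" for i j
      using that neq[of i j] neq[of i p] neq[of p j] n by (auto simp: inversions_def)
    then show ?thesis
      unfolding cut_at_def n[symmetric] by (intro iff_allI) blast
  qed
  show ?thesis
  proof
    assume "\<exists>a b. a \<le> \<alpha> ! p \<and> ?T = {a..\<alpha> ! p} \<union> {b..n}"
    then obtain a b where ab: "a \<le> \<alpha> ! p" "?T = {a..\<alpha> ! p} \<union> {b..n}" by blast
    show "cut_at \<alpha> p"
      unfolding cut_at
    proof clarify
      fix i j assume ij: "i < p" "p < j" "j < n" "\<alpha> ! i < \<alpha> ! j"
      have "\<alpha> ! i \<in> {a..\<alpha> ! p} \<union> {b..n}" "\<alpha> ! j \<notin> {a..\<alpha> ! p} \<union> {b..n}"
        using inT[of i] inT[of j] ij ab(2) by auto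
      then show "\<alpha> ! i < \<alpha> ! p \<and> \<alpha> ! p < \<alpha> ! j"
        using ij neq[of i p] range[of j] p by auto
    qed
  next
    assume "cut_at \<alpha> p"
    then have c: "\<alpha> ! i < \<alpha> ! p \<and> \<alpha> ! p < \<alpha> ! j"
      if "i < p" "p < j" "j < n" "\<alpha> ! i < \<alpha> ! j" for i j
      using that cut_at by blast
    let ?L = "{v \<in> ?T. v \<le> \<alpha> ! p}" and ?H = "{v \<in> ?T. \<alpha> ! p < v}"
    have pT: "\<alpha> ! p \<in> ?T" using inT[OF p] by simp
    have obtT: "\<exists>i\<le>p. v = \<alpha> ! i" if "v \<in> ?T" for v
      using that p n by (auto simp: in_set_conv_nth less_Suc_eq_le)
    \<comment> \<open>A missing \<open>v\<close> would sit after \<open>p\<close>, and the cut would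
      place \<open>\<alpha> ! p\<close> between \<open>u\<close> and \<open>v\<close>, although both
      lie on the same side of it.\<close>
    have up: "v \<in> ?T" if u: "u \<in> ?T" and uv: "u \<le> v" "v \<le> n" and v: "v \<le> \<alpha> ! p \<or> \<alpha> ! p < u" for u v
    proof (rule ccontr)
      assume nv: "v \<notin> ?T"
      obtain i where i: "i \<le> p" "u = \<alpha> ! i" using obtT[OF u] by blast
      have "1 \<le> v" using range[of i] i p uv by simp
      then obtain j where j: "j < n" "v = \<alpha> ! j" using obt uv(2) by blast
      have pj: "p < j" using inT[OF j(1)] nv j(2) by simp
      have less: "u < v" using u nv uv(1) by (metis order_le_less)
      show False
      proof (cases "i = p")
        case True
        then show False using less i v by auto
      next
        case False
        then show False using c[of i j] i j pj less v by auto
      qed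
    qed
    define a where "a = Min ?L"
    \<comment> \<open>The default \<open>Suc n\<close> makes the second interval empty.\<close>
    define b where "b = (if ?H = {} then Suc n else Min ?H)"
    have aL: "a \<in> ?L" unfolding a_def using pT by (intro Min_in) auto
    have aLe: "a \<le> v" if "v \<in> ?L" for v unfolding a_def using that by (intro Min_le) auto
    have bH: "b \<in> ?H" if "?H \<noteq> {}"
    proof -
      have "Min ?H \<in> ?H" using that by (intro Min_in) auto
      then show ?thesis using that by (simp only: b_def if_False)
    qed
    have bLe: "b \<le> v" if "v \<in> ?H" for v
    proof -
      have "Min ?H \<le> v" using that by (intro Min_le) auto
      moreover have "?H \<noteq> {}" using that by blast
      ultimately show ?thesis by (simp only: b_def if_False)
    qed
    have Tn: "v \<le> n" if "v \<in> ?T" for v using that set by (metis in_set_takeD atLeastAtMost_iff)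
    have "?T = {a..\<alpha> ! p} \<union> {b..n}"
    proof (intro set_eqI iffI)
      fix v assume v: "v \<in> ?T"
      show "v \<in> {a..\<alpha> ! p} \<union> {b..n}"
      proof (cases "v \<le> \<alpha> ! p")
        case True
        then show ?thesis using v aLe[of v] by auto
      next
        case False
        then show ?thesis using v bLe[of v] Tn[of v] by auto
      qed
    next
      fix v assume "v \<in> {a..\<alpha> ! p} \<union> {b..n}"
      then consider "a \<le> v" "v \<le> \<alpha> ! p" | "b \<le> v" "v \<le> n" by auto
      then show "v \<in> ?T"
      proof cases
        case 1
        then show ?thesis using up[of a v] aL range(2)[OF p] by auto
      next
        case 2
        have "?H \<noteq> {}"
        proof
          assume "?H = {}"
          then have "b = Suc n" by (simp only: b_def simp_thms if_True)
          then show False using 2 by simp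
        qed
        then show ?thesis using up[of b v] bH 2 by blast
      qed
    qed
    moreover have "a \<le> \<alpha> ! p" using aL by blast
    ultimately show "\<exists>a b. a \<le> \<alpha> ! p \<and> ?T = {a..\<alpha> ! p} \<union> {b..n}" by blast
  qed
qed

text \<open>The index shift is \<open>k = Suc p\<close>. The two end positions are cuts of every
  permutation and are therefore excluded.\<close>

lemma non_secable_iff_cut:
  "non_secable \<alpha> \<longleftrightarrow> \<alpha> \<in> Perms \<and> length \<alpha> \<ge> 2 \<and> (\<forall>p. 1 \<le> p \<and> p < length \<alpha> - 1 \<longrightarrow> \<not> cut_at \<alpha> p)"
proof -
  let ?n = "length \<alpha>"
  have "(\<forall>k. 2 \<le> k \<and> k < ?n \<longrightarrow>
           \<not> (\<exists>a b. a \<le> \<alpha> ! (k - 1) \<and> set (take k \<alpha>) = {a..\<alpha> ! (k - 1)} \<union> {b..?n}))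
      \<longleftrightarrow> (\<forall>p. 1 \<le> p \<and> p < ?n - 1 \<longrightarrow> \<not> cut_at \<alpha> p)" (is "?A \<longleftrightarrow> ?B")
    if perm: "\<alpha> \<in> permutations_of_set {1..?n}"
  proof
    assume A: ?A
    show ?B
    proof clarify
      fix p assume p: "1 \<le> p" "p < ?n - 1" "cut_at \<alpha> p"
      have "Suc p < ?n" using p by linarith
      then show False using p
        using A[rule_format, of "Suc p"] cut_iff_intervals[OF perm refl, of p] by auto
    qed
  next
    assume B: ?B
    show ?A
    proof (intro allI impI)
      fix k assume k: "2 \<le> k \<and> k < ?n"
      then obtain p where p: "k = Suc p" by (cases k) auto
      then have "1 \<le> p" "p < ?n - 1" "p < ?n" using k by linarith+
      then show "\<not> (\<exists>a b. a \<le> \<alpha> ! (k - 1) \<and> set (take k \<alpha>) = {a..\<alpha> ! (k - 1)} \<union> {b..?n})"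
        using B cut_iff_intervals[OF perm refl, of p] unfolding p by simp
    qed
  qed
  then show ?thesis
    unfolding non_secable_def Let_def Perms_def by auto
qed

section \<open>Composition of permutations along a common letter\<close>

text \<open>
  The values are arranged as: low part of \<open>\<beta>\<close>, low part of \<open>\<alpha>\<close>, common letter, high part of \<open>\<beta>\<close>,
  high part of \<open>\<alpha>\<close>; this creates all inversions across the common letter that are not excluded by
  transitivity.
\<close>

definition perm_comp :: "nat list \<Rightarrow> nat list \<Rightarrow> nat list" where
  "perm_comp \<alpha> \<beta> = (let n = length \<alpha>; m = length \<beta> in std (
     map (\<lambda>x. if x < last \<alpha> then x + m else if x = last \<alpha> then n + m else x + n + 2 * m) \<alpha> @
     map (\<lambda>y. if y < hd \<beta> then y else y + n + m) (tl \<beta>)))"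

lemma length_perm_comp: "\<beta> \<noteq> [] \<Longrightarrow> Suc (length (perm_comp \<alpha> \<beta>)) = length \<alpha> + length \<beta>"
  by (simp add: perm_comp_def Let_def)

text \<open>The two overlapping blocks keep the inversions of \<open>\<alpha>\<close> and
  \<open>\<beta>\<close>. A pair across position \<open>p\<close> stays uninverted only if the
  common letter separates it in increasing order, which is what makes the composition the largest
  possible.\<close>

lemma inversions_perm_comp:
  assumes "\<alpha> \<in> Perms" "\<beta> \<in> Perms" and p: "p = length \<alpha> - 1"
  shows "(i, j) \<in> inversions (perm_comp \<alpha> \<beta>) \<longleftrightarrow>
    (if j \<le> p then (i, j) \<in> inversions \<alpha>
     else if p \<le> i then (i - p, j - p) \<in> inversions \<beta>
     else j - p < length \<beta> \<and> ((i, p) \<in> inversions \<alpha> \<or> (0, j - p) \<in> inversions \<beta>))"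
proof -
  let ?n = "length \<alpha>" and ?m = "length \<beta>"
  have ne: "\<alpha> \<noteq> []" "\<beta> \<noteq> []" using assms by (auto simp: Perms_def)
  have n: "?n = Suc p" using p ne by (cases \<alpha>) auto
  have lst: "last \<alpha> = \<alpha> ! p" using ne p by (simp add: last_conv_nth)
  have hd: "hd \<beta> = \<beta> ! 0" using ne by (simp add: hd_conv_nth)
  have A: "1 \<le> \<alpha> ! i" "\<alpha> ! i \<le> ?n" if "i < ?n" for i
    using assms(1) that nth_mem[OF that] by (auto simp: Perms_def permutations_of_set_def)
  have B: "1 \<le> \<beta> ! i" "\<beta> ! i \<le> ?m" if "i < ?m" for i
    using assms(2) that nth_mem[OF that] by (auto simp: Perms_def permutations_of_set_def)
  have dA: "\<alpha> ! i = \<alpha> ! j \<longleftrightarrow> i = j" if "i < ?n" "j < ?n" for i j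
    using that assms(1) by (auto simp: Perms_def permutations_of_set_def nth_eq_iff_index_eq)
  have dB: "\<beta> ! i = \<beta> ! j \<longleftrightarrow> i = j" if "i < ?m" "j < ?m" for i j
    using that assms(2) by (auto simp: Perms_def permutations_of_set_def nth_eq_iff_index_eq)
  \<comment> \<open>Since \<open>std\<close> keeps inversions, it suffices to compare letters of
    \<open>w\<close>. The shifts separate the five blocks because the letters of
    \<open>\<alpha>\<close> are at most \<open>?n\<close> and those of \<open>\<beta>\<close> at
    most \<open>?m\<close>.\<close>
  define w where "w =
     map (\<lambda>x. if x < last \<alpha> then x + ?m else if x = last \<alpha> then ?n + ?m else x + ?n + 2 * ?m) \<alpha> @
     map (\<lambda>y. if y < hd \<beta> then y else y + ?n + ?m) (tl \<beta>)"
  have inv: "inversions (perm_comp \<alpha> \<beta>) = inversions w"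
    by (simp add: perm_comp_def w_def Let_def)
  have len: "length w = p + ?m" using n ne by (simp add: w_def)
  have invw: "(i, j) \<in> inversions (perm_comp \<alpha> \<beta>) \<longleftrightarrow> i < j \<and> j < p + ?m \<and> w ! j < w ! i"
    unfolding inv by (simp add: inversions_def len)
  have invA: "(k, l) \<in> inversions \<alpha> \<longleftrightarrow> k < l \<and> l < ?n \<and> \<alpha> ! l < \<alpha> ! k" for k l
    by (simp add: inversions_def)
  have invB: "(k, l) \<in> inversions \<beta> \<longleftrightarrow> k < l \<and> l < ?m \<and> \<beta> ! l < \<beta> ! k" for k l
    by (simp add: inversions_def)
  have w1: "w ! i = (if \<alpha> ! i < \<alpha> ! p then \<alpha> ! i + ?m else if i = p then ?n + ?m else \<alpha> ! i + ?n + 2 * ?m)"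
    if "i \<le> p" for i
    using that n dA[of i p] by (auto simp: w_def nth_append lst)
  have w2: "w ! j = (if \<beta> ! (j - p) < \<beta> ! 0 then \<beta> ! (j - p) else \<beta> ! (j - p) + ?n + ?m)"
    if "p < j" "j < p + ?m" for j
    using that n by (auto simp: w_def nth_append hd nth_tl Suc_diff_Suc)
  \<comment> \<open>The case \<open>p = i\<close> is separate: in \<open>w\<close> the common letter
    comes from \<open>\<alpha>\<close>, while the claim refers to it as the first letter of
    \<open>\<beta>\<close>.\<close>
  consider "j \<le> p" | "p < j" "p = i" | "p < j" "p < i" | "p < j" "i < p" by linarith
  then show ?thesis
  proof cases
    case 1
    show ?thesis
    proof (cases "i < j")
      case True
      have "0 < ?m" using ne by simp
      then have "w ! j < w ! i \<longleftrightarrow> \<alpha> ! j < \<alpha> ! i"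
        using 1 True A[of i] A[of j] A[of p] dA[of i j] dA[of i p] dA[of j p] n w1[of i] w1[of j]
        by (auto split: if_splits)
      moreover have "j < p + ?m" using 1 \<open>0 < ?m\<close> by linarith
      ultimately show ?thesis unfolding invw invA invB using 1 True n len by simp
    qed (use 1 in \<open>auto simp: invw invA\<close>)
  next
    case 2
    show ?thesis
    proof (cases "j < p + ?m")
      case True
      then show ?thesis unfolding invw invA invB
        using 2 A[of p] B[of "j - p"] dB[of "j - p" 0] n len by (auto simp: w1 w2)
    qed (use 2 len in \<open>auto simp: invw invA invB\<close>)
  next
    case 3
    show ?thesis
    proof (cases "i < j \<and> j < p + ?m")
      case True
      then show ?thesis unfolding invw invA invB
        using 3 B[of "j - p"] B[of "i - p"] dB[of "j - p" "i - p"] n len by (auto simp: w2)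
    qed (use 3 len in \<open>auto simp: invw invA invB\<close>)
  next
    case 4
    show ?thesis
    proof (cases "j < p + ?m")
      case True
      then have jm: "j - p < ?m" "j - p \<noteq> 0" using 4 by auto
      then show ?thesis unfolding invw invA invB
        using 4 True B[of "j - p"] dB[of "j - p" 0] A[of i] A[of p] dA[of i p] n len
        by (auto simp: w1 w2)
    qed (use 4 len in \<open>auto simp: invw invA invB\<close>)
  qed
qed

lemma perm_comp_in_Perms: "\<alpha> \<in> Perms \<Longrightarrow> perm_comp \<alpha> \<beta> \<in> Perms"
  unfolding perm_comp_def Let_def by (rule std_in_Perms) (auto simp: Perms_def)

lemma cut_perm_comp:
  assumes "\<alpha> \<in> Perms" "\<beta> \<in> Perms"
  shows "cut_at (perm_comp \<alpha> \<beta>) (length \<alpha> - 1)"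
proof -
  have "length \<alpha> \<ge> 1" "length \<beta> \<ge> 1" using assms by (auto simp: Perms_def Suc_le_eq)
  moreover have "Suc (length (perm_comp \<alpha> \<beta>)) = length \<alpha> + length \<beta>"
    using assms by (intro length_perm_comp) (auto simp: Perms_def)
  ultimately show ?thesis
    unfolding cut_at_def by (auto simp: inversions_perm_comp[OF assms refl])
qed

text \<open>Prefix and suffix fix the inversions inside the two blocks and the cut fixes those
  across, so together they determine \<open>\<mu>\<close>. Factorizing a permutation thus amounts to
  finding its cuts.\<close>

lemma perm_comp_iff:
  assumes "\<alpha> \<in> Perms" "\<beta> \<in> Perms" "\<mu> \<in> Perms"
  shows "perm_comp \<alpha> \<beta> = \<mu> \<longleftrightarrow> Suc (length \<mu>) = length \<alpha> + length \<beta> \<and> cut_at \<mu> (length \<alpha> - 1) \<and>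
    std (take (length \<alpha>) \<mu>) = \<alpha> \<and> std (drop (length \<alpha> - 1) \<mu>) = \<beta>"
    (is "?l \<longleftrightarrow> ?r")
proof -
  define p where "p = length \<alpha> - 1"
  have ne: "\<alpha> \<noteq> []" "\<beta> \<noteq> []" using assms by (auto simp: Perms_def)
  then have n: "length \<alpha> = Suc p" and m: "length \<beta> > 0" by (cases \<alpha>; auto simp: p_def)+
  note len = length_perm_comp[OF ne(2), of \<alpha>]
  note inv = inversions_perm_comp[OF assms(1,2) p_def]
  have std_iff: "std w = \<sigma> \<longleftrightarrow> length w = length \<sigma> \<and> inversions w = inversions \<sigma>"
    if "\<sigma> \<in> Perms" for w :: "nat list" and \<sigma>
    using std_eq_iff[of w \<sigma>] std_Perms[OF that] by simp
  show ?thesis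
  proof
    assume l: ?l
    have "inversions (take (Suc p) \<mu>) = inversions \<alpha>"
      using n by (auto simp: inversions_take inv simp flip: l) (auto simp: inversions_def)
    moreover have "inversions (drop p \<mu>) = inversions \<beta>"
      by (auto simp: inversions_drop inv simp flip: l) (auto simp: inversions_def)
    ultimately show ?r
      using l cut_perm_comp[OF assms(1,2)] len n m assms
      by (auto simp: std_iff simp del: length_greater_0_conv)
  next
    assume r: ?r
    then have lenr: "Suc (length \<mu>) = length \<alpha> + length \<beta>" by blast
    have t: "inversions (take (Suc p) \<mu>) = inversions \<alpha>" and d: "inversions (drop p \<mu>) = inversions \<beta>"
      using r n assms by (auto simp: std_iff)
    have c: "(i, p) \<notin> inversions \<mu> \<and> (p, j) \<notin> inversions \<mu>"
      if "i < p" "p < j" "j < length \<mu>" "(i, j) \<notin> inversions \<mu>" for i j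
      using r that n by (auto simp: cut_at_def)
    have "(i, j) \<in> inversions (perm_comp \<alpha> \<beta>) \<longleftrightarrow> (i, j) \<in> inversions \<mu>" for i j
    proof -
      consider "j \<le> p" | "p < j" "p \<le> i" | "p < j" "i < p" by linarith
      then show ?thesis
      proof cases
        case 1
        then show ?thesis by (auto simp: inv inversions_take simp flip: t)
      next
        case 2
        then show ?thesis by (auto simp: inv inversions_drop simp flip: d)
      next
        case 3
        have "j < length \<mu> \<longleftrightarrow> j - p < length \<beta>" using lenr n 3 by auto
        \<comment> \<open>If neither pair with the middle position were inverted, transitivity would
          exclude \<open>(i, j)\<close>. The converse is the cut condition \<open>c\<close>.\<close>
        moreover have "(i, p) \<in> inversions \<mu> \<or> (p, j) \<in> inversions \<mu>" if "(i, j) \<in> inversions \<mu>"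
          using that 3 by (auto simp: inversions_def)
        moreover have "j < length \<mu>" if "(i, j) \<in> inversions \<mu>"
          using that by (simp add: inversions_def)
        moreover have "(i, p) \<in> inversions \<alpha> \<longleftrightarrow> (i, p) \<in> inversions \<mu>"
          by (simp add: inversions_take flip: t)
        moreover have "(0, j - p) \<in> inversions \<beta> \<longleftrightarrow> (p, j) \<in> inversions \<mu>"
          using 3 by (simp add: inversions_drop flip: d)
        moreover have "(i, j) \<in> inversions (perm_comp \<alpha> \<beta>) \<longleftrightarrow>
            j - p < length \<beta> \<and> ((i, p) \<in> inversions \<alpha> \<or> (0, j - p) \<in> inversions \<beta>)"
          using 3 by (simp add: inv)
        ultimately show ?thesis
          using 3 c[of i j] by blast
      qed
    qed
    then show ?l
      using lenr len by (intro Perms_eqI perm_comp_in_Perms assms) auto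
  qed
qed

section \<open>Unique factorization into non-secable permutations\<close>

definition compose_list :: "nat list list \<Rightarrow> nat list" where
  "compose_list w = foldr perm_comp w [1]"

lemma compose_list_simps [simp]:
  "compose_list [] = [1]" "compose_list (\<alpha> # w) = perm_comp \<alpha> (compose_list w)"
  by (simp_all add: compose_list_def)

lemma one_in_Perms: "[1] \<in> Perms"
  by (simp add: Perms_def permutations_of_set_def)

lemma compose_list_in_Perms: "w \<in> lists Perms \<Longrightarrow> compose_list w \<in> Perms"
  by (cases w) (auto simp: one_in_Perms[simplified] perm_comp_in_Perms)

lemma non_secable_Perms: "{\<alpha>. non_secable \<alpha>} \<subseteq> Perms"
  by (auto simp: non_secable_iff_cut)

text \<open>The length of the first factor is recovered as the first positive cut of the product.\<close>

lemma perm_comp_non_secable_length_le: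
  assumes "non_secable \<alpha>" "non_secable \<alpha>'" "\<beta> \<in> Perms" "\<beta>' \<in> Perms"
    and eq: "perm_comp \<alpha> \<beta> = perm_comp \<alpha>' \<beta>'"
  shows "length \<alpha> \<le> length \<alpha>'"
proof (rule ccontr)
  assume less: "\<not> length \<alpha> \<le> length \<alpha>'"
  have P: "\<alpha> \<in> Perms" "\<alpha>' \<in> Perms" "length \<alpha>' \<ge> 2"
    and nc: "\<And>p. 1 \<le> p \<Longrightarrow> p < length \<alpha> - 1 \<Longrightarrow> \<not> cut_at \<alpha> p"
    using assms by (auto simp: non_secable_iff_cut)
  have "std (take (length \<alpha>) (perm_comp \<alpha> \<beta>)) = \<alpha>"
    using perm_comp_iff[of \<alpha> \<beta> "perm_comp \<alpha> \<beta>"] P assms by (simp add: perm_comp_in_Perms)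
  \<comment> \<open>The cut at the end of the shorter factor survives in the prefix that
    standardizes to \<open>\<alpha>\<close>, where it is an inner cut.\<close>
  moreover have "cut_at (std (take (length \<alpha>) (perm_comp \<alpha> \<beta>))) (length \<alpha>' - 1)"
    using cut_perm_comp[OF P(2) assms(4)] by (simp add: eq cut_take)
  moreover have "1 \<le> length \<alpha>' - 1" "length \<alpha>' - 1 < length \<alpha> - 1"
    using less P(3) by linarith+
  ultimately show False
    using nc[of "length \<alpha>' - 1"] by auto
qed

text \<open>Comparing both ways gives equal lengths; then both pairs are standardizations of the
  same prefix and suffix.\<close>

lemma perm_comp_non_secable_inject:
  assumes "non_secable \<alpha>" "non_secable \<alpha>'" "\<beta> \<in> Perms" "\<beta>' \<in> Perms"
    and eq: "perm_comp \<alpha> \<beta> = perm_comp \<alpha>' \<beta>'"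
  shows "\<alpha> = \<alpha>' \<and> \<beta> = \<beta>'"
proof -
  have len: "length \<alpha> = length \<alpha>'"
    using perm_comp_non_secable_length_le assms by (metis order_antisym)
  have P: "\<alpha> \<in> Perms" "\<alpha>' \<in> Perms"
    using assms by (auto simp: non_secable_iff_cut)
  then show ?thesis
    using perm_comp_iff[of \<alpha> \<beta> "perm_comp \<alpha> \<beta>"] perm_comp_iff[of \<alpha>' \<beta>' "perm_comp \<alpha>' \<beta>'"] assms len
    by (simp add: perm_comp_in_Perms)
qed

lemma inj_on_compose_list: "inj_on compose_list (lists {\<alpha>. non_secable \<alpha>})"
proof (rule inj_onI)
  have P: "compose_list w \<in> Perms" if "w \<in> lists {\<alpha>. non_secable \<alpha>}" for w
    using compose_list_in_Perms lists_mono[OF non_secable_Perms] that by blast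
  \<comment> \<open>A non-secable first factor has length at least 2, so a nonempty product does
    too.\<close>
  have ne: "compose_list (\<alpha> # w) \<noteq> [1]" if "\<alpha> # w \<in> lists {\<alpha>. non_secable \<alpha>}" for \<alpha> w
    using that length_perm_comp[of "compose_list w" \<alpha>] P[of w]
    by (auto simp: non_secable_iff_cut Perms_def)
  fix v w assume "v \<in> lists {\<alpha>. non_secable \<alpha>}" "w \<in> lists {\<alpha>. non_secable \<alpha>}"
    "compose_list v = compose_list w"
  then show "v = w"
  proof (induction v arbitrary: w rule: list.induct)
    case Nil
    then show ?case using ne by (cases w) force+
  next
    case (Cons \<alpha> v)
    note IH = Cons.IH and prems = Cons.prems
    show ?case
    proof (cases w)
      case Nil
      then show ?thesis using ne[OF prems(1)] prems(3) by simp
    next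
      case (Cons \<alpha>' v')
      then show ?thesis
        using perm_comp_non_secable_inject[of \<alpha> \<alpha>' "compose_list v" "compose_list v'"]
          prems IH[of v'] P[of v] P[of v'] by auto
    qed
  qed
qed

text \<open>Cut at the first positive cut: the prefix is non-secable, and the suffix is shorter and
  handled by induction.\<close>

lemma Perms_subset_compose_list:
  "\<mu> \<in> Perms \<Longrightarrow> \<mu> \<in> compose_list ` lists {\<alpha>. non_secable \<alpha>}"
proof (induction "length \<mu>" arbitrary: \<mu> rule: less_induct)
  case less
  show ?case
  proof (cases "length \<mu> = 1")
    case True
    then show ?thesis
      using length_one_Perms[OF less.prems] by (intro image_eqI[of _ _ "[]"]) auto
  next
    case False
    then have N: "length \<mu> \<ge> 2" using less.prems by (cases \<mu>) (auto simp: Perms_def Suc_le_eq)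
    \<comment> \<open>Such a \<open>q\<close> exists because the last position is always a cut;
      \<open>q = 0\<close> is ruled out so that the suffix gets shorter.\<close>
    define q where "q = (LEAST q. 1 \<le> q \<and> cut_at \<mu> q)"
    have ex: "1 \<le> length \<mu> - 1 \<and> cut_at \<mu> (length \<mu> - 1)" using N by (auto intro: cut_last)
    have q: "1 \<le> q" "cut_at \<mu> q"
      using LeastI[of "\<lambda>q. 1 \<le> q \<and> cut_at \<mu> q", OF ex] by (auto simp: q_def)
    have qN: "q \<le> length \<mu> - 1"
      unfolding q_def using ex by (rule Least_le)
    have least: "\<not> cut_at \<mu> r" if "1 \<le> r" "r < q" for r
      using not_less_Least[of r "\<lambda>q. 1 \<le> q \<and> cut_at \<mu> q"] that by (auto simp: q_def)
    define \<alpha> where "\<alpha> = std (take (Suc q) \<mu>)"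
    define \<beta> where "\<beta> = std (drop q \<mu>)"
    have len: "length \<alpha> = Suc q" "length \<beta> = length \<mu> - q"
      using qN N by (auto simp: \<alpha>_def \<beta>_def)
    have P: "\<alpha> \<in> Perms" "\<beta> \<in> Perms"
      unfolding \<alpha>_def \<beta>_def using qN N by (auto intro!: std_in_Perms)
    have "non_secable \<alpha>"
      using P(1) len q least cut_of_take[OF q(2)] by (auto simp: non_secable_iff_cut \<alpha>_def)
    moreover have "perm_comp \<alpha> \<beta> = \<mu>"
      using P less.prems len qN N q by (subst perm_comp_iff) (auto simp: \<alpha>_def \<beta>_def)
    moreover have "\<beta> \<in> compose_list ` lists {\<alpha>. non_secable \<alpha>}"
      using P(2) len q N by (intro less.hyps) auto
    then obtain w where "w \<in> lists {\<alpha>. non_secable \<alpha>}" "\<beta> = compose_list w"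
      by blast
    ultimately show ?thesis by (intro image_eqI[of _ _ "\<alpha> # w"]) auto
  qed
qed

section \<open>The algebra \<open>FQSym\<close>\<close>

interpretation series: vector_space "series_scale :: 'k::field \<Rightarrow> ('x \<Rightarrow> 'k) \<Rightarrow> 'x \<Rightarrow> 'k"
  by unfold_locales (auto simp: series_scale_def fun_eq_iff algebra_simps)

lemma sum_fun_apply: "sum f I x = (\<Sum>i\<in>I. f i x)"
  for f :: "'i \<Rightarrow> 'x \<Rightarrow> 'b::comm_monoid_add"
  by (induction I rule: infinite_finite_induct) auto

text \<open>A factorization of \<open>w\<close> with one letter of overlap is given by the position
  of the common letter.\<close>

lemma sharp_eq_sum: "sharp f g w = (\<Sum>i<length w. f (take (Suc i) w) * g (drop i w))"
  unfolding sharp_def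
proof (rule sum.reindex_bij_witness[where
      i = "\<lambda>i. (take (Suc i) w, drop i w)" and j = "\<lambda>(p, q). length p - 1"])
  fix z assume "z \<in> {(p, q). sharp_word p q = Some w}"
  then obtain p q where z: "z = (p, q)" and pq: "p \<noteq> []" "q \<noteq> []" "last p = hd q" "w = p @ tl q"
    by (auto simp: sharp_word_def split: if_splits)
  obtain u x where p: "p = u @ [x]" using pq(1) by (cases p rule: rev_exhaust) auto
  obtain v where q: "q = x # v" using pq(2,3) p by (cases q) auto
  show "(\<lambda>i. (take (Suc i) w, drop i w)) ((\<lambda>(p, q). length p - 1) z) = z"
    and "(\<lambda>(p, q). length p - 1) z \<in> {..<length w}"
    and "f (take (Suc ((\<lambda>(p, q). length p - 1) z)) w) * g (drop ((\<lambda>(p, q). length p - 1) z) w)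
      = (case z of (p, q) \<Rightarrow> f p * g q)"
    by (simp_all add: z pq(4) p q)
next
  fix i assume "i \<in> {..<length w}"
  then have i: "i < length w" by simp
  show "(\<lambda>(p, q). length p - 1) (take (Suc i) w, drop i w) = i"
    using i by simp
  have "last (take (Suc i) w) = hd (drop i w)"
    using i by (simp add: take_Suc_conv_app_nth hd_drop_conv_nth)
  moreover have "take (Suc i) w @ tl (drop i w) = w"
    by (metis append_take_drop_id drop_Suc tl_drop)
  ultimately show "(take (Suc i) w, drop i w) \<in> {(p, q). sharp_word p q = Some w}"
    using i by (auto simp: sharp_word_def)
qed

text \<open>Both sides sum over pairs of positions \<open>j \<le> i\<close> of the two common
  letters; they differ in which one is chosen first.\<close>

lemma sharp_assoc: "sharp (sharp f g) h = sharp f (sharp g h)"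
proof
  fix w
  let ?t = "\<lambda>j i. f (take (Suc j) w) * g (drop j (take (Suc i) w)) * h (drop i w)"
  let ?D = "{(i, j). j \<le> i \<and> i < length w}"
  have fin: "finite ?D"
    by (rule finite_subset[of _ "{..<length w} \<times> {..<length w}"]) auto
  have "sharp (sharp f g) h w = (\<Sum>i<length w. \<Sum>j\<le>i. ?t j i)"
    unfolding sharp_eq_sum sum_distrib_right
    by (intro sum.cong refl) (auto simp: min_def)
  also have "\<dots> = (\<Sum>(i, j)\<in>?D. ?t j i)"
    by (subst sum.Sigma) (auto intro!: sum.cong)
  also have "\<dots> = (\<Sum>(j, k)\<in>(SIGMA j:{..<length w}. {..<length w - j}). ?t j (j + k))"
    by (rule sum.reindex_bij_witness[where i = "\<lambda>(j, k). (j + k, j)" and j = "\<lambda>(i, j). (j, i - j)"])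
      auto
  also have "\<dots> = sharp f (sharp g h) w"
    unfolding sharp_eq_sum sum_distrib_left
    by (subst sum.Sigma[symmetric])
      (auto intro!: sum.cong simp: mult.assoc add.commute drop_take)
  finally show "sharp (sharp f g) h w = sharp f (sharp g h) w" .
qed

text \<open>These are the possibly infinite linear combinations of the series
  \<open>G \<sigma>\<close>.\<close>

definition std_invariant :: "('a::linorder list \<Rightarrow> 'k) \<Rightarrow> bool" where
  "std_invariant f \<longleftrightarrow> (\<forall>w v. std w = std v \<longrightarrow> f w = f v)"

text \<open>The standardization of a word determines those of its prefixes and suffixes. Closure of
  \<open>FQSym\<close> under the product follows without computing structure constants.\<close>

lemma std_invariant_sharp:
  assumes "std_invariant f" "std_invariant g"
  shows "std_invariant (sharp f g)"
  unfolding std_invariant_def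
proof (intro allI impI)
  fix w v :: "'a list" assume "std w = std v"
  then have "length w = length v" "\<And>i. std (take i w) = std (take i v)"
    "\<And>i. std (drop i w) = std (drop i v)"
    by (auto simp: std_eq_iff inversions_take inversions_drop)
  then show "sharp f g w = sharp f g v"
    using assms unfolding sharp_eq_sum std_invariant_def by (metis (no_types, lifting) sum.cong)
qed

lemma std_invariant_in_span:
  fixes f :: "'a::linorder list \<Rightarrow> 'k::field"
  assumes "std_invariant f" "finite (std ` {w. f w \<noteq> 0})"
  shows "f \<in> series.span (G ` std ` {w. f w \<noteq> 0})"
proof -
  let ?P = "std ` {w. f w \<noteq> 0}"
  \<comment> \<open>The coefficient of \<open>G \<sigma>\<close> is the value of \<open>f\<close> at
    any word standardizing to \<open>\<sigma>\<close>; only attained \<open>\<sigma>\<close> enter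
    the sum.\<close>
  define c where "c \<sigma> = f (SOME w. std w = \<sigma>)" for \<sigma>
  have c: "c (std w) = f w" for w
  proof -
    have "std (SOME v :: 'a list. std v = std w) = std w" for w :: "'a list"
      by (rule someI[of _ w]) simp
    then show ?thesis using assms(1) unfolding c_def std_invariant_def by blast
  qed
  let ?s = "(\<Sum>\<sigma>\<in>?P. series_scale (c \<sigma>) (G \<sigma>)) :: 'a list \<Rightarrow> 'k"
  have "f = ?s"
  proof
    fix w :: "'a list"
    have "?s w = (\<Sum>\<sigma>\<in>?P. if \<sigma> = std w then c (std w) else 0)"
      unfolding sum_fun_apply by (intro sum.cong) (auto simp: series_scale_def G_def)
    also have "\<dots> = f w"
      using assms(2) by (auto simp: sum.delta c)
    finally show "f w = ?s w" by simp
  qed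
  moreover have "?s \<in> series.span (G ` ?P)"
    by (intro series.span_sum series.span_scale series.span_base) blast
  ultimately show ?thesis by simp
qed

lemma finite_std_image:
  fixes W :: "'a::linorder list set"
  assumes "\<And>w. w \<in> W \<Longrightarrow> length w \<le> N"
  shows "finite (std ` W)"
proof (rule finite_subset)
  show "std ` W \<subseteq> (\<Union>n\<le>N. permutations_of_set {1..n})"
    using std_in_permutations assms by fastforce
qed auto

lemma FQSym_eq: "(FQSym :: ('a::linorder list \<Rightarrow> 'k::field) set) = series.span (G ` Perms)"
proof -
  have "{G \<sigma> | \<sigma> n. n \<ge> 1 \<and> \<sigma> \<in> permutations_of_set {1..n}} = (G ` Perms :: ('a list \<Rightarrow> 'k) set)"
  proof -
    have "(\<exists>n\<ge>1. \<sigma> \<in> permutations_of_set {1..n}) \<longleftrightarrow> \<sigma> \<in> Perms" for \<sigma> :: "nat list"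
    proof -
      have "length \<sigma> = n" if "\<sigma> \<in> permutations_of_set {1..n}" for n
        using length_finite_permutations_of_set[OF that] by simp
      then show ?thesis
        unfolding Perms_def by (cases \<sigma>) auto
    qed
    then show ?thesis by blast
  qed
  then show ?thesis by (simp add: FQSym_def)
qed

text \<open>Membership is described by coefficients, so that the algebra axioms can be checked
  pointwise. Finiteness is a bound on length, since the support of \<open>G \<sigma>\<close> may be
  infinite; \<open>f [] = 0\<close> reflects \<open>n \<ge> 1\<close>.\<close>

lemma FQSym_iff:
  "f \<in> FQSym \<longleftrightarrow> std_invariant f \<and> f [] = 0 \<and> (\<exists>N. \<forall>w. f w \<noteq> 0 \<longrightarrow> length w \<le> N)"
    (is "_ \<longleftrightarrow> ?P f")
  for f :: "'a::linorder list \<Rightarrow> 'k::field"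
proof
  have "series.subspace (Collect ?P)"
  proof (rule series.subspaceI)
    fix f g :: "'a list \<Rightarrow> 'k" assume "f \<in> Collect ?P" "g \<in> Collect ?P"
    then obtain M N where "\<forall>w. f w \<noteq> 0 \<longrightarrow> length w \<le> M" "\<forall>w. g w \<noteq> 0 \<longrightarrow> length w \<le> N"
      and *: "std_invariant f" "std_invariant g" "f [] = 0" "g [] = 0"
      by blast
    then have "\<forall>w. (f + g) w \<noteq> 0 \<longrightarrow> length w \<le> max M N"
      by (metis add_0 le_max_iff_disj plus_fun_apply)
    moreover have "std_invariant (f + g)"
      using * unfolding std_invariant_def by (metis plus_fun_apply)
    ultimately show "f + g \<in> Collect ?P" using * by auto
  next
    show "0 \<in> Collect ?P" by (simp add: std_invariant_def)
  next
    fix c and f :: "'a list \<Rightarrow> 'k" assume "f \<in> Collect ?P"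
    then have "std_invariant f" "f [] = 0" "\<exists>N. \<forall>w. f w \<noteq> 0 \<longrightarrow> length w \<le> N"
      by blast+
    then show "series_scale c f \<in> Collect ?P"
      unfolding std_invariant_def series_scale_def mem_Collect_eq
      by (metis mult_zero_right)
  qed
  moreover have "G ` Perms \<subseteq> Collect ?P"
  proof clarify
    fix \<sigma> assume "\<sigma> \<in> Perms"
    then have "\<sigma> \<noteq> []" by (simp add: Perms_def)
    moreover have "std ([] :: 'a list) = []" by (simp add: std_def)
    ultimately show "?P (G \<sigma>)"
      by (auto simp: G_def std_invariant_def intro!: exI[of _ "length \<sigma>"])
  qed
  ultimately have "series.span (G ` Perms) \<subseteq> Collect ?P"
    by (intro series.span_minimal)
  then show "?P f" if "f \<in> FQSym" using that by (auto simp: FQSym_eq)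
next
  assume f: "?P f"
  then have "f \<in> series.span (G ` std ` {w. f w \<noteq> 0})"
    by (intro std_invariant_in_span) (auto intro: finite_std_image)
  moreover have "std ` {w. f w \<noteq> 0} \<subseteq> Perms"
    using f by (force intro: std_in_Perms)
  ultimately show "f \<in> FQSym"
    unfolding FQSym_eq by (meson image_mono series.span_mono subsetD)
qed

lemma unital_algebra_FQSym:
  "unital_algebra series_scale (FQSym :: ('a::linorder list \<Rightarrow> 'k::field) set) sharp (G [1])"
proof unfold_locales
  show "series.subspace FQSym"
    by (simp add: FQSym_eq)
  show "sharp f g \<in> FQSym" if fg: "f \<in> FQSym" "g \<in> FQSym" for f g :: "'a list \<Rightarrow> 'k"
  proof -
    obtain M N where MN: "\<And>w. f w \<noteq> 0 \<Longrightarrow> length w \<le> M" "\<And>w. g w \<noteq> 0 \<Longrightarrow> length w \<le> N"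
      using fg unfolding FQSym_iff by blast
    have "length w \<le> M + N" if "sharp f g w \<noteq> 0" for w
    proof -
      obtain i where "i < length w" "f (take (Suc i) w) * g (drop i w) \<noteq> 0"
        using \<open>sharp f g w \<noteq> 0\<close> unfolding sharp_eq_sum
        by (metis (no_types, lifting) lessThan_iff sum.neutral)
      then show ?thesis using MN(1)[of "take (Suc i) w"] MN(2)[of "drop i w"] by auto
    qed
    then show ?thesis
      using fg std_invariant_sharp[of f g] by (auto simp: FQSym_iff sharp_eq_sum)
  qed
  show "(G [1] :: 'a list \<Rightarrow> 'k) \<in> FQSym"
    unfolding FQSym_eq by (intro series.span_base imageI one_in_Perms)
  show "sharp (f + g) h = sharp f h + sharp g h" for f g h :: "'a list \<Rightarrow> 'k"
    by (rule ext) (simp add: sharp_eq_sum sum.distrib distrib_right)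
  show "sharp f (g + h) = sharp f g + sharp f h" for f g h :: "'a list \<Rightarrow> 'k"
    by (rule ext) (simp add: sharp_eq_sum sum.distrib distrib_left)
  show "sharp (series_scale c f) g = series_scale c (sharp f g)" for c and f g :: "'a list \<Rightarrow> 'k"
    by (rule ext) (simp add: sharp_eq_sum series_scale_def sum_distrib_left mult.assoc)
  show "sharp f (series_scale c g) = series_scale c (sharp f g)" for c and f g :: "'a list \<Rightarrow> 'k"
    by (rule ext) (simp add: sharp_eq_sum series_scale_def sum_distrib_left mult.left_commute)
  show "sharp (sharp f g) h = sharp f (sharp g h)" for f g h :: "'a list \<Rightarrow> 'k"
    by (rule sharp_assoc)
  show "sharp (G [1]) f = f" if "f \<in> FQSym" for f :: "'a list \<Rightarrow> 'k"
  proof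
    fix w :: "'a list"
    \<comment> \<open>\<open>G [1]\<close> is the sum of all one-letter words, so only the overlap
      in the first letter survives.\<close>
    have "sharp (G [1]) f w = (\<Sum>i<length w. if i = 0 then f w else 0)"
      unfolding sharp_eq_sum by (intro sum.cong) (auto simp: G_def std_eq_one_iff[simplified])
    then show "sharp (G [1]) f w = f w"
      using that by (auto simp: FQSym_iff)
  qed
  show "sharp f (G [1]) = f" if "f \<in> FQSym" for f :: "'a list \<Rightarrow> 'k"
  proof
    fix w :: "'a list"
    \<comment> \<open>Only the last letter remains as overlap. For \<open>w = []\<close> the sum is
      empty, in agreement with \<open>f [] = 0\<close>.\<close>
    have "sharp f (G [1]) w = (\<Sum>i<length w. if i = length w - 1 then f w else 0)"
      unfolding sharp_eq_sum by (intro sum.cong) (auto simp: G_def std_eq_one_iff[simplified])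
    then show "sharp f (G [1]) w = f w"
      using that by (cases "w = []") (auto simp: FQSym_iff)
  qed
qed

section \<open>Unitriangularity\<close>

text \<open>\<open>f\<close> is \<open>G \<sigma>\<close> plus a linear combination of \<open>G \<tau>\<close> with \<open>\<tau> < \<sigma>\<close> in the left weak order.\<close>

definition leading :: "nat list \<Rightarrow> ('a::linorder list \<Rightarrow> 'k::field) \<Rightarrow> bool" where
  "leading \<sigma> f \<longleftrightarrow> std_invariant f \<and>
     (\<forall>w. f w \<noteq> 0 \<longrightarrow> length w = length \<sigma> \<and> inversions w \<subseteq> inversions \<sigma>) \<and>
     (\<forall>w. std w = \<sigma> \<longrightarrow> f w = 1)"

lemma leading_in_FQSym: "\<sigma> \<in> Perms \<Longrightarrow> leading \<sigma> f \<Longrightarrow> f \<in> FQSym"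
proof -
  assume "\<sigma> \<in> Perms" and f: "leading \<sigma> f"
  then have "\<sigma> \<noteq> []" by (simp add: Perms_def)
  moreover have len: "length w = length \<sigma>" if "f w \<noteq> 0" for w
    using f that unfolding leading_def by blast
  ultimately have "f [] = 0" by fastforce
  then show ?thesis
    using f len by (auto simp: FQSym_iff leading_def intro!: exI[of _ "length \<sigma>"])
qed

lemma leading_G: "leading \<sigma> (G \<sigma>)"
  by (auto simp: leading_def G_def std_invariant_def)

text \<open>At most one summand is nonzero at \<open>w\<close>, the one for \<open>std w\<close>; so
  \<open>S \<sigma>\<close> is the indicator of the words of the right length with inversions inside
  those of \<open>\<sigma>\<close>.\<close>

lemma leading_S: "leading \<sigma> (S \<sigma> :: 'a::linorder list \<Rightarrow> 'k::field)"
proof -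
  let ?T = "{\<tau> \<in> permutations_of_set {1..length \<sigma>}. left_weak_le \<tau> \<sigma>}"
  have "(S \<sigma> w :: 'k) = (if length w = length \<sigma> \<and> inversions w \<subseteq> inversions \<sigma> then 1 else 0)"
    for w :: "'a list"
  proof -
    have "(S \<sigma> w :: 'k) = (\<Sum>\<tau>\<in>?T. if \<tau> = std w then 1 else 0)"
      unfolding S_def sum_fun_apply by (intro sum.cong) (auto simp: G_def)
    also have "\<dots> = (if std w \<in> ?T then 1 else 0)"
      by simp
    also have "std w \<in> ?T \<longleftrightarrow> length w = length \<sigma> \<and> inversions w \<subseteq> inversions \<sigma>"
      using std_in_permutations[of w] by (auto simp: left_weak_le_def Inv_eq_inversions)
    finally show ?thesis .
  qed
  then show ?thesis
    by (auto simp: leading_def std_invariant_def std_eq_iff)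
qed

text \<open>By homogeneity only one overlap position contributes. A word in the support has its
  prefix and suffix below \<open>\<alpha>\<close> and \<open>\<beta>\<close>, hence lies below
  \<open>perm_comp \<alpha> \<beta>\<close>; at the top both coefficients are 1.\<close>

lemma leading_sharp:
  fixes f g :: "'a::linorder list \<Rightarrow> 'k::field"
  assumes P: "\<alpha> \<in> Perms" "\<beta> \<in> Perms" and f: "leading \<alpha> f" and g: "leading \<beta> g"
  shows "leading (perm_comp \<alpha> \<beta>) (sharp f g)"
  unfolding leading_def
proof (intro conjI allI impI)
  show "std_invariant (sharp f g)"
    using f g by (auto simp: leading_def intro: std_invariant_sharp)
  define p where "p = length \<alpha> - 1"
  have ne: "\<alpha> \<noteq> []" "\<beta> \<noteq> []" using P by (auto simp: Perms_def)
  then have n: "length \<alpha> = Suc p" by (cases \<alpha>) (auto simp: p_def)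
  have m: "0 < length \<beta>" using ne by simp
  have sharp: "sharp f g w = (if p < length w then f (take (Suc p) w) * g (drop p w) else 0)" for w
  proof -
    have "sharp f g w = (\<Sum>i<length w. if i = p then f (take (Suc p) w) * g (drop p w) else 0)"
      unfolding sharp_eq_sum
    proof (intro sum.cong refl)
      fix i assume i: "i \<in> {..<length w}"
      show "f (take (Suc i) w) * g (drop i w) =
          (if i = p then f (take (Suc p) w) * g (drop p w) else 0)"
      proof (cases "i = p")
        case False
        then have "length (take (Suc i) w) \<noteq> length \<alpha>" using i n by simp
        then have "f (take (Suc i) w) = 0" using f unfolding leading_def by blast
        then show ?thesis using False by simp
      qed simp
    qed
    then show ?thesis by simp
  qed
  fix w :: "'a list"
  {
    assume "sharp f g w \<noteq> 0"
    then have w: "p < length w" "f (take (Suc p) w) \<noteq> 0" "g (drop p w) \<noteq> 0"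
      by (auto simp: sharp split: if_splits)
    then have d: "length (drop p w) = length \<beta>"
      and tI: "inversions (take (Suc p) w) \<subseteq> inversions \<alpha>"
      and dI: "inversions (drop p w) \<subseteq> inversions \<beta>"
      using f g by (auto simp: leading_def)
    show len: "length w = length (perm_comp \<alpha> \<beta>)"
      using d w(1) n m length_perm_comp[OF ne(2), of \<alpha>] by simp
    show "inversions w \<subseteq> inversions (perm_comp \<alpha> \<beta>)"
    proof clarify
      fix i j assume ij: "(i, j) \<in> inversions w"
      consider "j \<le> p" | "p < j" "p \<le> i" | "p < j" "i < p" by linarith
      then show "(i, j) \<in> inversions (perm_comp \<alpha> \<beta>)"
      proof cases
        case 1
        then have "(i, j) \<in> inversions (take (Suc p) w)" using ij by (simp add: inversions_take)
        then show ?thesis using tI 1 by (auto simp: inversions_perm_comp[OF P p_def])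
      next
        case 2
        then have "(i - p, j - p) \<in> inversions (drop p w)" using ij by (simp add: inversions_drop)
        then show ?thesis using dI 2 by (auto simp: inversions_perm_comp[OF P p_def])
      next
        case 3
        \<comment> \<open>An inversion across \<open>p\<close> forces an inversion with the common
          letter, which already belongs to one of the factors.\<close>
        have "(i, p) \<in> inversions w \<or> (p, j) \<in> inversions w" "j < length w"
          using ij 3 by (auto simp: inversions_def)
        moreover have "(i, p) \<in> inversions \<alpha>" if "(i, p) \<in> inversions w"
          using tI that by (auto simp: inversions_take)
        moreover have "(0, j - p) \<in> inversions \<beta>" if "(p, j) \<in> inversions w"
          using dI that 3 by (auto simp: inversions_drop)
        moreover have "j - p < length \<beta>" if "j < length w"
          using that d 3 by auto
        ultimately show ?thesis
          using 3 by (auto simp: inversions_perm_comp[OF P p_def])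
      qed
    qed
  }
  {
    assume w: "std w = perm_comp \<alpha> \<beta>"
    let ?\<mu> = "perm_comp \<alpha> \<beta>"
    have \<mu>: "std (take (Suc p) ?\<mu>) = \<alpha>" "std (drop p ?\<mu>) = \<beta>" "Suc (length ?\<mu>) = Suc p + length \<beta>"
      using perm_comp_iff[OF P perm_comp_in_Perms[OF P(1), of \<beta>]] n by auto
    have I: "inversions w = inversions ?\<mu>" "length w = length ?\<mu>"
      using w by (metis inversions_std, metis length_std)
    then have "std (take (Suc p) w) = std (take (Suc p) ?\<mu>)" "std (drop p w) = std (drop p ?\<mu>)"
      by (simp_all add: std_eq_iff inversions_take inversions_drop)
    then have "std (take (Suc p) w) = \<alpha>" "std (drop p w) = \<beta>"
      by (simp_all only: \<mu>(1,2))
    then show "sharp f g w = 1"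
      using f g I(2) \<mu>(3) m by (auto simp: sharp leading_def)
  }
qed

section \<open>Products of generators, independence and spanning\<close>

lemma leading_foldr_sharp:
  assumes "\<And>\<alpha>. \<alpha> \<in> set w \<Longrightarrow> \<alpha> \<in> Perms" "\<And>\<alpha>. \<alpha> \<in> set w \<Longrightarrow> leading \<alpha> (T \<alpha>)"
  shows "leading (compose_list w) (foldr sharp (map T w) (G [1]))"
  using assms
proof (induction w)
  case (Cons \<alpha> w)
  then have "compose_list w \<in> Perms" by (intro compose_list_in_Perms) auto
  with Cons show ?case by (auto intro!: leading_sharp)
qed (simp add: leading_G)

text \<open>Copying \<open>\<sigma>\<close> into the alphabet along \<open>a\<close> preserves
  inversions. Here the infinite alphabet enters: every \<open>G \<sigma>\<close> is nonzero.\<close>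

lemma ex_word_std:
  fixes a :: "nat \<Rightarrow> 'a::linorder"
  assumes "strict_mono a" "\<sigma> \<in> Perms"
  shows "\<exists>w :: 'a list. std w = \<sigma>"
proof
  have "inversions (map a \<sigma>) = inversions \<sigma>"
    using strict_mono_less[OF assms(1)] by (auto simp: inversions_def)
  then show "std (map a \<sigma>) = \<sigma>"
    using std_cong[of "map a \<sigma>" \<sigma>] std_Perms[OF assms(2)]
    by (metis std_eq_iff length_map length_std inversions_std std_cong)
qed

lemma leading_le:
  fixes a :: "nat \<Rightarrow> 'a::linorder" and f :: "'a list \<Rightarrow> 'k::field"
  assumes "strict_mono a" "\<sigma> \<in> Perms" "leading \<sigma> f" "leading \<tau> f"
  shows "length \<sigma> = length \<tau> \<and> inversions \<sigma> \<subseteq> inversions \<tau>"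
proof -
  obtain w :: "'a list" where w: "std w = \<sigma>" using ex_word_std assms(1,2) by blast
  then have "f w \<noteq> 0" using assms(3) by (simp add: leading_def)
  then show ?thesis using assms(4) w unfolding leading_def by (metis inversions_std length_std)
qed

text \<open>Antisymmetry of the left weak order.\<close>

lemma leading_unique:
  fixes a :: "nat \<Rightarrow> 'a::linorder" and f :: "'a list \<Rightarrow> 'k::field"
  assumes "strict_mono a" "\<sigma> \<in> Perms" "\<tau> \<in> Perms" "leading \<sigma> f" "leading \<tau> f"
  shows "\<sigma> = \<tau>"
  using leading_le[OF assms(1,2,4,5)] leading_le[OF assms(1,3,5,4)] assms(2,3)
  by (intro Perms_eqI) auto

text \<open>In a vanishing combination, choose a term whose leading permutation has the most
  inversions, and evaluate at a word standardizing to it.\<close>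

lemma independent_leading:
  fixes a :: "nat \<Rightarrow> 'a::linorder" and B :: "('a list \<Rightarrow> 'k::field) set"
  assumes a: "strict_mono a" and ex: "\<And>f. f \<in> B \<Longrightarrow> \<exists>\<sigma>\<in>Perms. leading \<sigma> f"
    and unique: "\<And>f g \<sigma>. f \<in> B \<Longrightarrow> g \<in> B \<Longrightarrow> \<sigma> \<in> Perms \<Longrightarrow> leading \<sigma> f \<Longrightarrow> leading \<sigma> g \<Longrightarrow> f = g"
  shows "series.independent B"
  unfolding series.independent_explicit_module
proof (intro allI impI, rule ccontr)
  fix t u v
  assume t: "finite t" "t \<subseteq> B" "(\<Sum>f\<in>t. series_scale (u f) f) = 0" "v \<in> t" "u v \<noteq> 0"
  obtain \<pi> where \<pi>: "\<And>f. f \<in> B \<Longrightarrow> \<pi> f \<in> Perms" "\<And>f. f \<in> B \<Longrightarrow> leading (\<pi> f) f"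
    using ex by metis
  let ?t = "{f \<in> t. u f \<noteq> 0}"
  let ?c = "\<lambda>f. card (inversions (\<pi> f))"
  have "finite (?c ` ?t)" "?c ` ?t \<noteq> {}" using t by auto
  then have "Max (?c ` ?t) \<in> ?c ` ?t" "\<forall>x \<in> ?c ` ?t. x \<le> Max (?c ` ?t)" by simp_all
  then obtain f where f: "f \<in> t" "u f \<noteq> 0" and max: "\<And>g. g \<in> t \<Longrightarrow> u g \<noteq> 0 \<Longrightarrow> ?c g \<le> ?c f"
    by (auto simp del: Max_less_iff)
  have fB: "f \<in> B" using f t by blast
  obtain w :: "'a list" where w: "std w = \<pi> f" using ex_word_std[OF a \<pi>(1)[OF fB]] by blast
  \<comment> \<open>Another term that is nonzero at \<open>w\<close> has its leading permutation
    above \<open>\<pi> f\<close>; maximality makes the two equal, and \<open>unique\<close> then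
    gives \<open>g = f\<close>.\<close>
  have "u g * g w = 0" if "g \<in> t" "g \<noteq> f" for g
  proof (rule ccontr)
    assume nz: "u g * g w \<noteq> 0"
    have gB: "g \<in> B" using that t by blast
    have le: "length (\<pi> f) = length (\<pi> g)" "inversions (\<pi> f) \<subseteq> inversions (\<pi> g)"
      using nz \<pi>(2)[OF gB] unfolding leading_def w[symmetric] by auto
    moreover have "?c g \<le> ?c f" using max[OF that(1)] nz by simp
    ultimately have "\<pi> f = \<pi> g"
      using \<pi>(1)[OF fB] \<pi>(1)[OF gB] card_seteq[OF finite_inversions le(2)] by (intro Perms_eqI) auto
    then show False using unique[OF fB gB \<pi>(1)[OF fB]] \<pi>(2)[OF fB] \<pi>(2)[OF gB] that(2) by simp
  qed
  then have "(\<Sum>g\<in>t - {f}. u g * g w) = 0"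
    by (intro sum.neutral) blast
  then have "(\<Sum>g\<in>t. u g * g w) = u f * f w"
    using f t(1) by (subst sum.remove[of t f]) simp_all
  moreover have "f w = 1" using \<pi>(2)[OF fB] w by (simp add: leading_def)
  moreover have "(\<Sum>g\<in>t. u g * g w) = 0"
    using fun_cong[OF t(3), of w] by (simp add: sum_fun_apply series_scale_def)
  ultimately show False using f(2) by simp
qed

text \<open>Triangular elimination by induction on the number of inversions.\<close>

lemma FQSym_subset_span_leading:
  fixes B :: "('a::linorder list \<Rightarrow> 'k::field) set"
  assumes ex: "\<And>\<sigma>. \<sigma> \<in> Perms \<Longrightarrow> \<exists>f\<in>B. leading \<sigma> f"
  shows "FQSym \<subseteq> series.span B"
proof -
  have "G \<sigma> \<in> series.span B" if "\<sigma> \<in> Perms" for \<sigma>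
    using that
  proof (induction "card (inversions \<sigma>)" arbitrary: \<sigma> rule: less_induct)
    case less
    obtain f where f: "f \<in> B" "leading \<sigma> f" using ex less.prems by blast
    \<comment> \<open>The part of \<open>f\<close> below the leading term, a combination of
      \<open>G \<tau>\<close> with fewer inversions.\<close>
    define g where "g = f - G \<sigma>"
    have g_nz: "length w = length \<sigma> \<and> inversions w \<subset> inversions \<sigma>" if "g w \<noteq> 0" for w
    proof -
      have "std w \<noteq> \<sigma>" using that f(2) by (auto simp: g_def G_def leading_def)
      then have "f w \<noteq> 0" using that by (auto simp: g_def G_def)
      then have "length w = length \<sigma>" "inversions w \<subseteq> inversions \<sigma>"
        using f(2) by (auto simp: leading_def)
      moreover have "inversions w \<noteq> inversions \<sigma>"
        using \<open>std w \<noteq> \<sigma>\<close> \<open>length w = length \<sigma>\<close> std_eq_iff[of w \<sigma>] std_Perms[OF less.prems] by auto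
      ultimately show ?thesis by blast
    qed
    have "std_invariant g"
      unfolding std_invariant_def
    proof (intro allI impI)
      fix w v :: "'a list" assume "std w = std v"
      moreover from this have "f w = f v"
        using f(2) unfolding leading_def std_invariant_def by blast
      ultimately show "g w = g v" by (simp add: g_def G_def)
    qed
    then have "g \<in> series.span (G ` std ` {w. g w \<noteq> 0})"
      using g_nz by (intro std_invariant_in_span finite_std_image[of _ "length \<sigma>"]) auto
    moreover have "G ` std ` {w. g w \<noteq> 0} \<subseteq> series.span B"
    proof clarify
      fix w assume "g w \<noteq> 0"
      then have w: "length w = length \<sigma>" "inversions w \<subset> inversions \<sigma>" using g_nz by blast+
      then have "w \<noteq> []" using less.prems by (auto simp: Perms_def)
      moreover have "card (inversions w) < card (inversions \<sigma>)"
        using w(2) by (intro psubset_card_mono finite_inversions)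
      ultimately show "G (std w) \<in> series.span B"
        by (intro less.hyps std_in_Perms) simp_all
    qed
    ultimately have "g \<in> series.span B"
      using series.span_minimal[OF _ series.subspace_span] by blast
    moreover have "f \<in> series.span B" using f(1) by (rule series.span_base)
    ultimately have "f - g \<in> series.span B" by (intro series.span_diff)
    then show ?case by (simp add: g_def)
  qed
  then show ?thesis
    unfolding FQSym_eq by (intro series.span_minimal) auto
qed

text \<open>Stated for an arbitrary unitriangular family \<open>T\<close>, to cover \<open>S\<close>
  and \<open>G\<close> at once.\<close>

lemma freely_generated_FQSym:
  fixes a :: "nat \<Rightarrow> 'a::linorder" and T :: "nat list \<Rightarrow> 'a list \<Rightarrow> 'k::field"
  assumes a: "strict_mono a" and T: "\<And>\<alpha>. \<alpha> \<in> Perms \<Longrightarrow> leading \<alpha> (T \<alpha>)"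
  shows "freely_generated_by series_scale (FQSym :: ('a list \<Rightarrow> 'k) set) sharp (G [1])
    (T ` {\<alpha>. non_secable \<alpha>})"
proof -
  interpret unital_algebra series_scale "FQSym :: ('a list \<Rightarrow> 'k) set" sharp "G [1]"
    by (rule unital_algebra_FQSym)
  let ?N = "{\<alpha>. non_secable \<alpha>}"
  let ?X = "T ` ?N"
  have X: "lists ?X = map T ` lists ?N" by (rule lists_image)
  have P: "compose_list u \<in> Perms" if "u \<in> lists ?N" for u
    using compose_list_in_Perms lists_mono[OF non_secable_Perms] that by blast
  have lead: "leading (compose_list u) (word_prod (map T u))" if "u \<in> lists ?N" for u
    using that non_secable_Perms T by (intro leading_foldr_sharp) blast+
  \<comment> \<open>A product determines its leading permutation and this its word of non-secable
    factors. Injectivity on words and distinctness of leading permutations both rest on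
    this.\<close>
  have eq: "u = v" if "u \<in> lists ?N" "v \<in> lists ?N" "leading \<sigma> (word_prod (map T u))"
    "leading \<sigma> (word_prod (map T v))" "\<sigma> \<in> Perms" for u v \<sigma>
  proof -
    have "compose_list u = \<sigma>" "compose_list v = \<sigma>"
      using leading_unique[OF a] lead P that by blast+
    then show ?thesis using inj_onD[OF inj_on_compose_list] that by metis
  qed
  show ?thesis
  proof (rule freely_generated_byI)
    show "?X \<subseteq> FQSym"
      using non_secable_Perms T leading_in_FQSym by blast
    show "inj_on word_prod (lists ?X)"
    proof (rule inj_onI)
      fix x y assume "x \<in> lists ?X" "y \<in> lists ?X" and xy: "word_prod x = word_prod y"
      then obtain u v where uv: "u \<in> lists ?N" "v \<in> lists ?N" "x = map T u" "y = map T v"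
        unfolding X by blast
      then show "x = y"
        using eq[of u v "compose_list u"] lead[of u] P[of u] xy by simp
    qed
    show "series.independent (word_prod ` lists ?X)"
    proof (rule independent_leading[OF a])
      show "\<exists>\<sigma>\<in>Perms. leading \<sigma> f" if "f \<in> word_prod ` lists ?X" for f
        using that lead P unfolding X by blast
      show "f = g" if "f \<in> word_prod ` lists ?X" "g \<in> word_prod ` lists ?X" "\<sigma> \<in> Perms"
        "leading \<sigma> f" "leading \<sigma> g" for f g \<sigma>
        using that eq unfolding X by blast
    qed
    show "FQSym \<subseteq> series.span (word_prod ` lists ?X)"
    proof (rule FQSym_subset_span_leading)
      fix \<sigma> assume "\<sigma> \<in> Perms"
      then obtain u where "u \<in> lists ?N" "\<sigma> = compose_list u"
        using Perms_subset_compose_list by blast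
      then show "\<exists>f\<in>word_prod ` lists ?X. leading \<sigma> f"
        using lead unfolding X by blast
    qed
  qed
qed

text \<open>The alphabet is a type with an increasing enumeration \<open>a\<close> of all its
  letters.\<close>

theorem theorem4p4:
  fixes a :: "nat \<Rightarrow> 'a::linorder"
  assumes "strict_mono a" and "range a = UNIV"
  shows "unital_algebra series_scale (FQSym :: ('a list \<Rightarrow> 'k::field) set) sharp (G [1]) \<and>
    freely_generated_by series_scale (FQSym :: ('a list \<Rightarrow> 'k) set) sharp (G [1])
      (S ` {\<alpha>. non_secable \<alpha>}) \<and>
    freely_generated_by series_scale (FQSym :: ('a list \<Rightarrow> 'k) set) sharp (G [1])
      (G ` {\<alpha>. non_secable \<alpha>})"
  by (rule conjI[OF unital_algebra_FQSym conjI[OF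
        freely_generated_FQSym[where T = S, OF assms(1) leading_S]
        freely_generated_FQSym[where T = G, OF assms(1) leading_G]]])

end
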